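(* Let $f_1,\dots,f_m\in\mathbb{R}[x_1,\dots,x_n]$ and assume $T=\{x\in\mathbb{R}^n: f_1(x)\ge 0,\dots,f_m(x)\ge 0\}$ is compact and has nonempty interior near $\partial_cT$, i.e., for every $u\in\partial_cT$ and every sufficiently small $\delta>0$ there exists $v\in B(u,\delta)$ such that $f_i(v)>0$ for all $i=1,\dots,m$. If for each $u\in\partial_cT$ and each $i$ for which $f_i(u)=0$, the polynomial $f_i$ is either sos-concave or strictly quasi-concave at $u$, then $\mathrm{conv}(T)$ is SDP representable.
   Context: For a set $T\subseteq\mathbb{R}^n$, the convex boundary is $\partial_cT=\{u\in T:\ \ell^Tu=\min_{x\in T}\ell^Tx\text{ for some }\ell\in\mathbb{R}^n\text{ with }\|\ell\|=1\}$. $B(u,\delta)$ is the open Euclidean ball; $\mathrm{conv}$ is the convex hull. A set $S\subseteq\mathbb{R}^n$ is SDP representable if there are $N\ge 0$ and real symmetric matrices $A_0,A_1,\dots,A_n,B_1,\dots,B_N$ of a common size such that $S=\{x\in\mathbb{R}^n:\exists u\in\mathbb{R}^N,\ A_0+\sum_{i=1}^n x_iA_i+\sum_{j=1}^N u_jB_j\succeq 0\}$, where $\succeq 0$ means positive semidefinite. A polynomial $g$ is sos-concave if $-\nabla^2 g(x)=W(x)^TW(x)$ for some (possibly nonsquare) matrix polynomial $W(x)$. A smooth function $f$ is strictly quasi-concave at $u$ if $-v^T\nabla^2 f(u)v>0$ for all $0\ne v\in\mathbb{R}^n$ with $\nabla f(u)^Tv=0$ (in particular, if $\nabla f(u)=0$,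 this requires $-\nabla^2 f(u)$ to be positive definite). *)

theory Defs
  imports "HOL-Analysis.Analysis"
begin

definition convex_boundary :: "(real ^ 'n) set \<Rightarrow> (real ^ 'n) set" where
  "convex_boundary T = {u \<in> T. \<exists>l. norm l = 1 \<and> (\<forall>x\<in>T. l \<bullet> u \<le> l \<bullet> x)}"


text \<open>
  The sizes of the matrices in a linear matrix inequality are existentially quantified in
  \<open>sdp_representable\<close>, so they cannot be types. A \<open>d\<close> by \<open>d\<close> matrix is therefore a function
  \<open>nat \<Rightarrow> nat \<Rightarrow> real\<close> of which only the entries with both indices below \<open>d\<close> matter.
\<close>

definition sym_mat :: "nat \<Rightarrow> (nat \<Rightarrow> nat \<Rightarrow> real) \<Rightarrow> bool" where
  "sym_mat d M \<longleftrightarrow> (\<forall>k<d. \<forall>l<d. M k l = M l k)"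

definition psd_mat :: "nat \<Rightarrow> (nat \<Rightarrow> nat \<Rightarrow> real) \<Rightarrow> bool" where
  "psd_mat d M \<longleftrightarrow> sym_mat d M \<and> (\<forall>z::nat \<Rightarrow> real. 0 \<le> (\<Sum>k<d. \<Sum>l<d. z k * M k l * z l))"

text \<open>
  The lifting vector \<open>u\<close> ranges over all functions on \<open>nat\<close>; only its entries at \<open>1, \<dots>, N\<close>
  are used.
\<close>

definition sdp_representable :: "(real ^ 'n) set \<Rightarrow> bool" where
  "sdp_representable S \<longleftrightarrow>
    (\<exists>(N::nat) (d::nat) (A0 :: nat \<Rightarrow> nat \<Rightarrow> real)
       (A :: 'n \<Rightarrow> nat \<Rightarrow> nat \<Rightarrow> real) (B :: nat \<Rightarrow> nat \<Rightarrow> nat \<Rightarrow> real).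
       sym_mat d A0 \<and> (\<forall>i. sym_mat d (A i)) \<and> (\<forall>j\<in>{1..N}. sym_mat d (B j)) \<and>
       S = {x. \<exists>u :: nat \<Rightarrow> real.
              psd_mat d (\<lambda>k l. A0 k l + (\<Sum>i\<in>UNIV. x $ i * A i k l) + (\<Sum>j=1..N. u j * B j k l))})"


definition partial_deriv :: "'n::finite \<Rightarrow> (real ^ 'n \<Rightarrow> real) \<Rightarrow> real ^ 'n \<Rightarrow> real" where
  "partial_deriv i f x = deriv (\<lambda>t. f (x + t *\<^sub>R axis i 1)) 0"

definition gradient :: "(real ^ 'n \<Rightarrow> real) \<Rightarrow> real ^ 'n \<Rightarrow> real ^ 'n" where
  "gradient f x = (\<chi> i. partial_deriv i f x)"

definition hessian :: "(real ^ 'n \<Rightarrow> real) \<Rightarrow> real ^ 'n \<Rightarrow> real ^ 'n ^ 'n" where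
  "hessian f x = (\<chi> i j. partial_deriv i (partial_deriv j f) x)"

text \<open>
  \<open>W x k j\<close> is the entry in row \<open>k\<close> and column \<open>j\<close> of a matrix polynomial with \<open>r\<close> rows, and the
  equation is \<open>- hessian g x = W(x)\<^sup>T W(x)\<close> entry by entry. Polynomials are identified with
  the functions they induce, which loses nothing over the reals.
\<close>

definition sos_concave :: "(real ^ 'n \<Rightarrow> real) \<Rightarrow> bool" where
  "sos_concave g \<longleftrightarrow>
    (\<exists>(r::nat) (W :: real ^ 'n \<Rightarrow> nat \<Rightarrow> 'n \<Rightarrow> real).
       (\<forall>k<r. \<forall>j. real_polynomial_function (\<lambda>x. W x k j)) \<and>
       (\<forall>x i j. (- hessian g x) $ i $ j = (\<Sum>k<r. W x k i * W x k j)))"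

definition strictly_quasi_concave_at :: "(real ^ 'n \<Rightarrow> real) \<Rightarrow> real ^ 'n \<Rightarrow> bool" where
  "strictly_quasi_concave_at f u \<longleftrightarrow>
    (\<forall>v. v \<noteq> 0 \<and> gradient f u \<bullet> v = 0 \<longrightarrow> - (v \<bullet> (hessian f u *v v)) > 0)"

end

theory Submission
  imports Defs
begin

text \<open>
  The extreme points of \<open>convex hull T\<close> lie in the convex boundary, which is compact, and the
  convex hull of finitely many bounded SDP representable sets is SDP representable (homogenize
  their linear matrix inequalities). So it suffices to represent the intersection of \<open>T\<close> with a
  small ball around each \<open>u\<close> in the convex boundary, and, since intersections preserve
  representability, to represent \<open>{x \<in> cball u \<delta>. 0 \<le> f x}\<close> for a single constraint \<open>f\<close>. If
  \<open>f\<close> is strictly quasi-concave at \<open>u\<close> and \<open>f u = 0\<close>, then for large \<open>c\<close> the polynomial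
  \<open>f - c f\<^sup>2 = f (1 - c f)\<close> has the same sign as \<open>f\<close> near \<open>u\<close> and a negative definite Hessian
  at \<open>u\<close>.

  The representation is the moment relaxation: \<open>a\<close> is the barycenter \<open>L(x)\<close> of a linear functional
  \<open>L\<close> on polynomials of bounded degree with \<open>L(1) = 1\<close>, \<open>L(q\<^sup>2) \<ge> 0\<close>, \<open>L(b q\<^sup>2) \<ge> 0\<close> and
  \<open>L(g) \<ge> 0\<close>, where \<open>b(x) = \<delta>\<^sup>2 - \<bar>x - u\<bar>\<^sup>2\<close>. It is exact because of Jensen's inequality
  \<open>L(g) \<le> g(a)\<close>: the function \<open>t \<mapsto> L(g(a + t (x - a)))\<close> has derivative \<open>0\<close> at \<open>t = 0\<close>, and it is
  concave as soon as the Hessian form of \<open>- g\<close> has a certificate in terms of squares and \<open>b\<close>. For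
  a negative definite Hessian at \<open>u\<close> such a certificate exists for all small \<open>\<delta>\<close>, because a
  polynomial vanishing at \<open>u\<close> is certifiably small on small balls around \<open>u\<close>.
\<close>

section \<open>Linear matrix inequalities\<close>

text \<open>The lifting variables are indexed by an arbitrary type, so that pairs, tagged unions and
  points of space can serve as indices; the renumbering to \<open>{1..N}\<close> is done once and
  for all in \<open>sdp_representable_lmi\<close>.\<close>

definition affine_form :: "'v set \<Rightarrow> (real ^ 'n \<Rightarrow> ('v \<Rightarrow> real) \<Rightarrow> real) \<Rightarrow> bool" where
  "affine_form V \<phi> \<longleftrightarrow>
    (\<exists>c0 c e. \<forall>x u. \<phi> x u = c0 + (\<Sum>i\<in>UNIV. x $ i * c i) + (\<Sum>j\<in>V. u j * e j))"

lemma affine_form_const: "affine_form V (\<lambda>x u. c)"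
  unfolding affine_form_def
  by (intro exI[of _ c] exI[of _ "\<lambda>i. 0"]) simp

lemma affine_form_coord: "affine_form V (\<lambda>x u. x $ i)"
  unfolding affine_form_def
  by (intro exI[of _ 0] exI[of _ "\<lambda>j. if j = i then 1 else 0"] exI[of _ "\<lambda>i. 0"])
     (simp add: if_distrib cong: if_cong)

lemma affine_form_var:
  assumes "finite V" "j \<in> V"
  shows "affine_form V (\<lambda>x u. u j)"
  unfolding affine_form_def
  using assms
  by (intro exI[of _ 0] exI[of _ "\<lambda>i. 0"] exI[of _ "\<lambda>k. if k = j then 1 else 0"])
     (simp add: if_distrib cong: if_cong)

lemma affine_form_add:
  assumes "affine_form V \<phi>" "affine_form V \<psi>"
  shows "affine_form V (\<lambda>x u. \<phi> x u + \<psi> x u)"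
proof -
  obtain c0 c e where
    "\<forall>x u. \<phi> x u = c0 + (\<Sum>i\<in>UNIV. x $ i * c i) + (\<Sum>j\<in>V. u j * e j)"
    using assms(1) unfolding affine_form_def by blast
  moreover obtain c0' c' e' where
    "\<forall>x u. \<psi> x u = c0' + (\<Sum>i\<in>UNIV. x $ i * c' i) + (\<Sum>j\<in>V. u j * e' j)"
    using assms(2) unfolding affine_form_def by blast
  ultimately show ?thesis unfolding affine_form_def
    by (intro exI[of _ "c0 + c0'"] exI[of _ "\<lambda>i. c i + c' i"] exI[of _ "\<lambda>i. e i + e' i"])
       (simp add: distrib_left sum.distrib)
qed

lemma affine_form_scale:
  assumes "affine_form V \<phi>"
  shows "affine_form V (\<lambda>x u. a * \<phi> x u)"
proof -
  obtain c0 c e where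
    "\<forall>x u. \<phi> x u = c0 + (\<Sum>i\<in>UNIV. x $ i * c i) + (\<Sum>j\<in>V. u j * e j)"
    using assms unfolding affine_form_def by blast
  then show ?thesis unfolding affine_form_def
    by (intro exI[of _ "a * c0"] exI[of _ "\<lambda>i. a * c i"] exI[of _ "\<lambda>i. a * e i"])
       (simp add: distrib_left sum_distrib_left mult_ac)
qed

lemma affine_form_scale_right:
  "affine_form V \<phi> \<Longrightarrow> affine_form V (\<lambda>x u. \<phi> x u * a)"
  using affine_form_scale[of V \<phi> a] by (simp add: mult.commute)

lemma affine_form_diff:
  "affine_form V \<phi> \<Longrightarrow> affine_form V \<psi> \<Longrightarrow> affine_form V (\<lambda>x u. \<phi> x u - \<psi> x u)"
  using affine_form_add[of V \<phi> "\<lambda>x u. (-1) * \<psi> x u"] affine_form_scale[of V \<psi> "-1"] by simp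

lemma affine_form_sum:
  assumes "\<And>k. k \<in> K \<Longrightarrow> affine_form V (\<phi> k)"
  shows "affine_form V (\<lambda>x u. \<Sum>k\<in>K. \<phi> k x u)"
  using assms
proof (induction K rule: infinite_finite_induct)
  case (insert k K)
  then show ?case by (simp add: affine_form_add)
qed (simp_all add: affine_form_const)

lemmas affine_form_intros = affine_form_const affine_form_coord affine_form_var affine_form_add
  affine_form_scale affine_form_scale_right affine_form_diff affine_form_sum

definition lmi :: "'v set \<Rightarrow> (real ^ 'n \<Rightarrow> ('v \<Rightarrow> real) \<Rightarrow> bool) \<Rightarrow> bool" where
  "lmi V C \<longleftrightarrow> (\<exists>d M. (\<forall>k<d. \<forall>l<d. affine_form V (M k l)) \<and>
     (\<forall>k<d. \<forall>l<d. \<forall>x u. M k l x u = M l k x u) \<and>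
     (\<forall>x u. C x u \<longleftrightarrow> psd_mat d (\<lambda>k l. M k l x u)))"

lemma lmiE:
  assumes "lmi V C"
  obtains d M where "\<forall>k<d. \<forall>l<d. affine_form V (M k l)"
    "\<forall>k<d. \<forall>l<d. \<forall>x u. M k l x u = M l k x u"
    "\<forall>x u. C x u \<longleftrightarrow> psd_mat d (\<lambda>k l. M k l x u)"
  using assms unfolding lmi_def by (elim exE conjE) (rule that)

lemma lmi_psd_mat:
  assumes "\<And>k l. k < d \<Longrightarrow> l < d \<Longrightarrow> affine_form V (M k l)"
    and "\<And>k l x u. k < d \<Longrightarrow> l < d \<Longrightarrow> M k l x u = M l k x u"
  shows "lmi V (\<lambda>x u. psd_mat d (\<lambda>k l. M k l x u))"
  using assms unfolding lmi_def by (intro exI[of _ d] exI[of _ M]) simp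

text \<open>An enumeration of \<open>I\<close> transports the matrix to natural indices. Block
  matrices can thus be indexed by disjoint sums and moment matrices by words.\<close>

lemma lmi_psd_form:
  fixes M :: "'i \<Rightarrow> 'i \<Rightarrow> real ^ 'n \<Rightarrow> ('v \<Rightarrow> real) \<Rightarrow> real"
  assumes "finite I"
    and aff: "\<And>k l. k \<in> I \<Longrightarrow> l \<in> I \<Longrightarrow> affine_form V (M k l)"
    and sym: "\<And>k l x u. k \<in> I \<Longrightarrow> l \<in> I \<Longrightarrow> M k l x u = M l k x u"
  shows "lmi V (\<lambda>x u. \<forall>z. 0 \<le> (\<Sum>k\<in>I. \<Sum>l\<in>I. z k * M k l x u * z l))"
proof -
  obtain h where h: "bij_betw h {..<card I} I"
    using ex_bij_betw_nat_finite[OF \<open>finite I\<close>] by (auto simp: atLeast0LessThan)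
  then have hI: "h k \<in> I" if "k < card I" for k
    using that by (auto simp: bij_betw_def)
  have *: "(\<Sum>k\<in>I. \<Sum>l\<in>I. z k * M k l x u * z l) =
      (\<Sum>k<card I. \<Sum>l<card I. z (h k) * M (h k) (h l) x u * z (h l))" for z x u
    by (simp add: sum.reindex_bij_betw[OF h, symmetric])
  have "(\<forall>z. 0 \<le> (\<Sum>k\<in>I. \<Sum>l\<in>I. z k * M k l x u * z l)) \<longleftrightarrow>
      psd_mat (card I) (\<lambda>k l. M (h k) (h l) x u)" (is "?L \<longleftrightarrow> ?R") for x u
  proof
    assume L: ?L
    have "0 \<le> (\<Sum>k<card I. \<Sum>l<card I. z k * M (h k) (h l) x u * z l)" for z
    proof -
      have "inv_into {..<card I} h (h k) = k" if "k < card I" for k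
        using h that by (auto simp: bij_betw_def)
      then show ?thesis
        using L[rule_format, of "z \<circ> inv_into {..<card I} h"] unfolding * by simp
    qed
    then show ?R unfolding psd_mat_def sym_mat_def using sym hI by auto
  next
    assume R: ?R
    show ?L
    proof
      fix z
      show "0 \<le> (\<Sum>k\<in>I. \<Sum>l\<in>I. z k * M k l x u * z l)"
        using R[unfolded psd_mat_def, THEN conjunct2, THEN spec, of "\<lambda>k. z (h k)"]
        unfolding * .
    qed
  qed
  then show ?thesis
    unfolding lmi_def using aff sym hI
    by (intro exI[of _ "card I"] exI[of _ "\<lambda>k l. M (h k) (h l)"]) auto
qed

text \<open>A scalar is a one by one matrix, indexed by \<open>unit\<close>.\<close>

lemma lmi_nonneg:
  assumes "affine_form V \<phi>"
  shows "lmi V (\<lambda>x u. 0 \<le> \<phi> x u)"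
proof -
  have "(\<forall>z::unit \<Rightarrow> real. 0 \<le> z () * a * z ()) \<longleftrightarrow> 0 \<le> a" for a :: real
  proof
    assume "\<forall>z::unit \<Rightarrow> real. 0 \<le> z () * a * z ()"
    from this[rule_format, of "\<lambda>_. 1"] show "0 \<le> a" by simp
  next
    assume "0 \<le> a"
    then have "0 \<le> a * (z () * z ())" for z :: "unit \<Rightarrow> real" by simp
    then show "\<forall>z::unit \<Rightarrow> real. 0 \<le> z () * a * z ()" by (simp add: mult_ac)
  qed
  then show ?thesis
    using lmi_psd_form[of "{()}" V "\<lambda>_ _. \<phi>"] assms by simp
qed

text \<open>The two matrices become the diagonal blocks of \<open>B\<close>, indexed by a disjoint
  sum; vectors supported on one block recover the single inequalities.\<close>

lemma lmi_conj:
  assumes "lmi V C" "lmi V D"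
  shows "lmi V (\<lambda>x u. C x u \<and> D x u)"
proof -
  obtain d M where M: "\<forall>k<d. \<forall>l<d. affine_form V (M k l)"
    "\<forall>k<d. \<forall>l<d. \<forall>x u. M k l x u = M l k x u"
    "\<forall>x u. C x u \<longleftrightarrow> psd_mat d (\<lambda>k l. M k l x u)"
    by (rule lmiE[OF assms(1)]) (rule that)
  obtain d' M' where M': "\<forall>k<d'. \<forall>l<d'. affine_form V (M' k l)"
    "\<forall>k<d'. \<forall>l<d'. \<forall>x u. M' k l x u = M' l k x u"
    "\<forall>x u. D x u \<longleftrightarrow> psd_mat d' (\<lambda>k l. M' k l x u)"
    by (rule lmiE[OF assms(2)]) (rule that)
  let ?I = "{..<d} <+> {..<d'}"
  define B where "B p q = (case (p, q) of (Inl k, Inl l) \<Rightarrow> M k l | (Inr k, Inr l) \<Rightarrow> M' k l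
    | _ \<Rightarrow> (\<lambda>x u. 0))" for p q
  have "lmi V (\<lambda>x u. \<forall>z. 0 \<le> (\<Sum>k\<in>?I. \<Sum>l\<in>?I. z k * B k l x u * z l))"
    using M(1,2) M'(1,2)
    by (intro lmi_psd_form) (auto simp: B_def affine_form_const)
  moreover have "(\<forall>z. 0 \<le> (\<Sum>k\<in>?I. \<Sum>l\<in>?I. z k * B k l x u * z l)) \<longleftrightarrow> C x u \<and> D x u"
    (is "?L \<longleftrightarrow> ?R") for x u
  proof -
    have eq: "(\<Sum>k\<in>?I. \<Sum>l\<in>?I. z k * B k l x u * z l) =
        (\<Sum>k<d. \<Sum>l<d. z (Inl k) * M k l x u * z (Inl l)) +
        (\<Sum>k<d'. \<Sum>l<d'. z (Inr k) * M' k l x u * z (Inr l))" for z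
      by (simp add: sum.Plus B_def)
    show ?thesis
    proof
      assume L: ?L
      have "0 \<le> (\<Sum>k<d. \<Sum>l<d. z k * M k l x u * z l)" for z
        using L[rule_format, of "case_sum z (\<lambda>_. 0)"] unfolding eq by simp
      moreover have "0 \<le> (\<Sum>k<d'. \<Sum>l<d'. z k * M' k l x u * z l)" for z
        using L[rule_format, of "case_sum (\<lambda>_. 0) z"] unfolding eq by simp
      ultimately show ?R using M M' unfolding psd_mat_def sym_mat_def by auto
    next
      assume ?R
      then show ?L using M(3) M'(3) unfolding eq psd_mat_def by (simp add: add_nonneg_nonneg)
    qed
  qed
  ultimately show ?thesis by simp
qed

lemma lmi_True: "lmi V (\<lambda>x u. True)"
  using lmi_nonneg[OF affine_form_const, of V 0] by simp

lemma lmi_eq: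
  assumes "affine_form V \<phi>" "affine_form V \<psi>"
  shows "lmi V (\<lambda>x u. \<phi> x u = \<psi> x u)"
proof -
  have "lmi V (\<lambda>x u. 0 \<le> \<phi> x u - \<psi> x u \<and> 0 \<le> \<psi> x u - \<phi> x u)"
    using assms by (intro lmi_conj lmi_nonneg affine_form_intros)
  also have "(\<lambda>x u. 0 \<le> \<phi> x u - \<psi> x u \<and> 0 \<le> \<psi> x u - \<phi> x u) = (\<lambda>x u. \<phi> x u = \<psi> x u)"
    by (auto simp: fun_eq_iff)
  finally show ?thesis .
qed

lemma lmi_ball:
  assumes "finite K" "\<And>k. k \<in> K \<Longrightarrow> lmi V (C k)"
  shows "lmi V (\<lambda>x u. \<forall>k\<in>K. C k x u)"
  using assms by (induction K rule: finite_induct) (simp_all add: lmi_True lmi_conj)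

lemma sdp_representable_lmi:
  fixes C :: "real ^ 'n \<Rightarrow> ('v \<Rightarrow> real) \<Rightarrow> bool"
  assumes "finite V" "lmi V C"
  shows "sdp_representable {x. \<exists>u. C x u}"
proof -
  obtain d M where M: "\<forall>k<d. \<forall>l<d. affine_form V (M k l)"
    "\<forall>k<d. \<forall>l<d. \<forall>x u. M k l x u = M l k x u"
    "\<forall>x u. C x u \<longleftrightarrow> psd_mat d (\<lambda>k l. M k l x u)"
    by (rule lmiE[OF assms(2)]) (rule that)
  have "\<forall>k l. \<exists>c0 c e. k < d \<longrightarrow> l < d \<longrightarrow>
      (\<forall>x u. M k l x u = c0 + (\<Sum>i\<in>UNIV. x $ i * c i) + (\<Sum>j\<in>V. u j * e j))"
    using M(1) unfolding affine_form_def by meson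
  then obtain c0 c e where ce: "\<And>k l x u. k < d \<Longrightarrow> l < d \<Longrightarrow>
      M k l x u = c0 k l + (\<Sum>i\<in>UNIV. x $ i * c k l i) + (\<Sum>j\<in>V. u j * e k l j)"
    by metis
  obtain h where h: "bij_betw h {1..card V} V"
    using ex_bij_betw_nat_finite_1[OF assms(1)] by blast
  \<comment> \<open>The coefficients were chosen separately for \<open>(k, l)\<close> and
    \<open>(l, k)\<close>. Averaging makes the coefficient matrices symmetric and keeps the values,
    since \<open>M\<close> is symmetric.\<close>
  define A0 where "A0 k l = (c0 k l + c0 l k) / 2" for k l
  define A where "A i k l = (c k l i + c l k i) / 2" for i k l
  define B where "B j k l = (e k l (h j) + e l k (h j)) / 2" for j k l
  have eq: "A0 k l + (\<Sum>i\<in>UNIV. x $ i * A i k l) + (\<Sum>j=1..card V. u (h j) * B j k l) = M k l x u"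
    if "k < d" "l < d" for k l x u
  proof -
    have 1: "(\<Sum>j\<in>V. u j * e k l j) = (\<Sum>j=1..card V. u (h j) * e k l (h j))" for k l
      by (simp add: sum.reindex_bij_betw[OF h, symmetric])
    have "A0 k l + (\<Sum>i\<in>UNIV. x $ i * A i k l) + (\<Sum>j=1..card V. u (h j) * B j k l) =
        (M k l x u + M l k x u) / 2"
      unfolding ce[OF that] ce[OF that(2,1)] 1 A0_def A_def B_def
      by (simp add: add_divide_distrib sum_divide_distrib distrib_left sum.distrib)
    then show ?thesis using M(2) that by simp
  qed
  have psd: "psd_mat d (\<lambda>k l. A0 k l + (\<Sum>i\<in>UNIV. x $ i * A i k l)
      + (\<Sum>j=1..card V. u (h j) * B j k l)) \<longleftrightarrow> C x u" for x u
    using eq M(3) unfolding psd_mat_def sym_mat_def by simp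
  have "{x. \<exists>u. C x u} = {x. \<exists>u. psd_mat d (\<lambda>k l. A0 k l + (\<Sum>i\<in>UNIV. x $ i * A i k l)
      + (\<Sum>j=1..card V. u j * B j k l))}"
  proof (intro Collect_cong iffI; elim exE)
    fix x u assume "C x u"
    then show "\<exists>u. psd_mat d (\<lambda>k l. A0 k l + (\<Sum>i\<in>UNIV. x $ i * A i k l)
      + (\<Sum>j=1..card V. u j * B j k l))"
      using psd[of x u] by (intro exI[of _ "u \<circ> h"]) simp
  next
    fix x u assume u: "psd_mat d (\<lambda>k l. A0 k l + (\<Sum>i\<in>UNIV. x $ i * A i k l)
      + (\<Sum>j=1..card V. u j * B j k l))"
    have "inv_into {1..card V} h (h j) = j" if "j \<in> {1..card V}" for j
      using h that by (auto simp: bij_betw_def)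
    then have "C x (u \<circ> inv_into {1..card V} h)"
      using u unfolding psd[symmetric] by simp
    then show "\<exists>u. C x u" by blast
  qed
  moreover have "sym_mat d A0" "\<And>i. sym_mat d (A i)" "\<And>j. sym_mat d (B j)"
    by (auto simp: sym_mat_def A0_def A_def B_def add.commute)
  ultimately show ?thesis unfolding sdp_representable_def by blast
qed

lemma sdp_representable_UNIV: "sdp_representable UNIV"
  using sdp_representable_lmi[OF finite.emptyI lmi_True] by simp

section \<open>Homogenized pencils, intersections and convex hulls of unions\<close>

lemma psd_mat_add:
  assumes "psd_mat d M" "psd_mat d M'"
  shows "psd_mat d (\<lambda>k l. M k l + M' k l)"
proof -
  have "(\<Sum>k<d. \<Sum>l<d. z k * (M k l + M' k l) * z l) =
    (\<Sum>k<d. \<Sum>l<d. z k * M k l * z l) + (\<Sum>k<d. \<Sum>l<d. z k * M' k l * z l)" for z :: "nat \<Rightarrow> real"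
    by (simp add: distrib_left distrib_right sum.distrib)
  then show ?thesis using assms unfolding psd_mat_def sym_mat_def by (simp add: add_nonneg_nonneg)
qed

lemma psd_mat_scale:
  assumes "psd_mat d M" "0 \<le> a"
  shows "psd_mat d (\<lambda>k l. a * M k l)"
proof -
  have "(\<Sum>k<d. \<Sum>l<d. z k * (a * M k l) * z l) = a * (\<Sum>k<d. \<Sum>l<d. z k * M k l * z l)"
    for z :: "nat \<Rightarrow> real"
    by (simp add: sum_distrib_left mult_ac)
  then show ?thesis using assms unfolding psd_mat_def sym_mat_def by simp
qed

text \<open>The coefficient \<open>a\<close> of the constant term homogenizes the linear matrix inequality.\<close>

definition pencil ::
  "nat \<Rightarrow> (nat \<Rightarrow> nat \<Rightarrow> real) \<Rightarrow> ('n::finite \<Rightarrow> nat \<Rightarrow> nat \<Rightarrow> real) \<Rightarrow> (nat \<Rightarrow> nat \<Rightarrow> nat \<Rightarrow> real) \<Rightarrow>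
    real \<Rightarrow> ('n \<Rightarrow> real) \<Rightarrow> (nat \<Rightarrow> real) \<Rightarrow> nat \<Rightarrow> nat \<Rightarrow> real" where
  "pencil N A0 A B a y u k l =
    a * A0 k l + (\<Sum>i\<in>UNIV. y i * A i k l) + (\<Sum>j=1..N. u j * B j k l)"

lemma sdp_representable_pencil:
  fixes S :: "(real ^ 'n) set"
  shows "sdp_representable S \<longleftrightarrow> (\<exists>N d A0 A B.
    sym_mat d A0 \<and> (\<forall>i. sym_mat d (A i)) \<and> (\<forall>j\<in>{1..N}. sym_mat d (B j)) \<and>
    S = {x. \<exists>u. psd_mat d (pencil N A0 A B 1 (vec_nth x) u)})"
  unfolding sdp_representable_def pencil_def[abs_def] by simp

lemma pencil_add:
  "pencil N A0 A B (a + a') (\<lambda>i. y i + y' i) (\<lambda>j. u j + u' j) k l =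
    pencil N A0 A B a y u k l + pencil N A0 A B a' y' u' k l"
  by (simp add: pencil_def distrib_right sum.distrib)

lemma pencil_scale:
  "pencil N A0 A B (c * a) (\<lambda>i. c * y i) (\<lambda>j. c * u j) k l = c * pencil N A0 A B a y u k l"
  by (simp add: pencil_def distrib_left sum_distrib_left mult_ac)

lemma psd_mat_pencil_add:
  assumes "psd_mat d (pencil N A0 A B a y u)" "psd_mat d (pencil N A0 A B a' y' u')"
  shows "psd_mat d (pencil N A0 A B (a + a') (\<lambda>i. y i + y' i) (\<lambda>j. u j + u' j))"
  using psd_mat_add[OF assms] by (simp add: pencil_add[symmetric])

lemma psd_mat_pencil_scale:
  assumes "psd_mat d (pencil N A0 A B a y u)" "0 \<le> c"
  shows "psd_mat d (pencil N A0 A B (c * a) (\<lambda>i. c * y i) (\<lambda>j. c * u j))"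
  using psd_mat_scale[OF assms] by (simp add: pencil_scale[symmetric])

lemma lmi_pencil:
  assumes "sym_mat d A0" "\<forall>i. sym_mat d (A i)" "\<forall>j\<in>{1..N}. sym_mat d (B j)"
    and "affine_form V \<phi>" "\<And>i. affine_form V (y i)" "\<And>j. j \<in> {1..N} \<Longrightarrow> affine_form V (w j)"
  shows "lmi V (\<lambda>x u. psd_mat d (pencil N A0 A B (\<phi> x u) (\<lambda>i. y i x u) (\<lambda>j. w j x u)))"
proof (rule lmi_psd_mat)
  fix k l assume kl: "k < d" "l < d"
  show "affine_form V (\<lambda>x u. pencil N A0 A B (\<phi> x u) (\<lambda>i. y i x u) (\<lambda>j. w j x u) k l)"
    unfolding pencil_def using assms(4-6)
    by (intro affine_form_add affine_form_sum affine_form_scale_right)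
  show "pencil N A0 A B (\<phi> x u) (\<lambda>i. y i x u) (\<lambda>j. w j x u) k l =
      pencil N A0 A B (\<phi> x u) (\<lambda>i. y i x u) (\<lambda>j. w j x u) l k" for x u
    using assms(1-3) kl unfolding pencil_def sym_mat_def by simp
qed

text \<open>The point \<open>x\<close> is shared, while the two groups of lifting variables are kept
  apart by a disjoint sum of index sets.\<close>

lemma sdp_representable_Int:
  assumes "sdp_representable S" "sdp_representable S'"
  shows "sdp_representable (S \<inter> S')"
proof -
  obtain N d A0 A B where S: "sym_mat d A0" "\<forall>i. sym_mat d (A i)" "\<forall>j\<in>{1..N}. sym_mat d (B j)"
    "S = {x. \<exists>u. psd_mat d (pencil N A0 A B 1 (vec_nth x) u)}"
    using assms(1) unfolding sdp_representable_pencil by blast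
  obtain N' d' A0' A' B' where S': "sym_mat d' A0'" "\<forall>i. sym_mat d' (A' i)"
    "\<forall>j\<in>{1..N'}. sym_mat d' (B' j)"
    "S' = {x. \<exists>u. psd_mat d' (pencil N' A0' A' B' 1 (vec_nth x) u)}"
    using assms(2) unfolding sdp_representable_pencil by blast
  let ?V = "{1..N} <+> {1..N'}"
  let ?C = "\<lambda>x u. psd_mat d (pencil N A0 A B 1 (vec_nth x) (\<lambda>j. u (Inl j)))
    \<and> psd_mat d' (pencil N' A0' A' B' 1 (vec_nth x) (\<lambda>j. u (Inr j)))"
  have "lmi ?V ?C"
    using S(1-3) S'(1-3) by (intro lmi_conj lmi_pencil affine_form_intros) auto
  then have "sdp_representable {x. \<exists>u. ?C x u}"
    by (intro sdp_representable_lmi) auto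
  also have "{x. \<exists>u. ?C x u} = S \<inter> S'"
  proof (intro equalityI subsetI)
    fix x assume "x \<in> {x. \<exists>u. ?C x u}"
    then show "x \<in> S \<inter> S'" unfolding S(4) S'(4) by blast
  next
    fix x assume "x \<in> S \<inter> S'"
    then obtain u v where "psd_mat d (pencil N A0 A B 1 (vec_nth x) u)"
      "psd_mat d' (pencil N' A0' A' B' 1 (vec_nth x) v)"
      unfolding S(4) S'(4) by blast
    then have "?C x (case_sum u v)" by simp
    then show "x \<in> {x. \<exists>u. ?C x u}" by blast
  qed
  finally show ?thesis .
qed

lemma sdp_representable_INT:
  assumes "finite K" "\<And>k. k \<in> K \<Longrightarrow> sdp_representable (S k)"
  shows "sdp_representable (\<Inter>k\<in>K. S k)"
  using assms
  by (induction K rule: finite_induct) (simp_all add: sdp_representable_UNIV sdp_representable_Int)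

lemma convex_sdp_representable:
  assumes "sdp_representable S"
  shows "convex S"
proof -
  obtain N d A0 A B where S: "S = {x. \<exists>u. psd_mat d (pencil N A0 A B 1 (vec_nth x) u)}"
    using assms unfolding sdp_representable_pencil by blast
  show ?thesis
  proof (rule convexI)
    fix x y and a b :: real assume "x \<in> S" "y \<in> S" and ab: "0 \<le> a" "0 \<le> b" "a + b = 1"
    then obtain u v where uv: "psd_mat d (pencil N A0 A B 1 (vec_nth x) u)"
      "psd_mat d (pencil N A0 A B 1 (vec_nth y) v)" unfolding S by blast
    have "psd_mat d (pencil N A0 A B 1 (vec_nth (a *\<^sub>R x + b *\<^sub>R y)) (\<lambda>j. a * u j + b * v j))"
      using psd_mat_pencil_add[OF psd_mat_pencil_scale[OF uv(1) ab(1)]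
          psd_mat_pencil_scale[OF uv(2) ab(2)]] ab(3)
      by (simp add: plus_vec_def scaleR_vec_def vec_lambda_inverse)
    then show "a *\<^sub>R x + b *\<^sub>R y \<in> S" unfolding S by blast
  qed
qed

text \<open>The products \<open>c k *\<^sub>R s k\<close> in a convex combination are not linear in
  the unknowns, so each is replaced by one vector constrained by the homogenized pencil with leading
  coefficient \<open>c k\<close>. For \<open>c k > 0\<close>, division by \<open>c k\<close>
  recovers a point of \<open>S k\<close>; for \<open>c k = 0\<close> the vector is a recession
  direction of \<open>S k\<close>, and boundedness makes it 0.\<close>

lemma sdp_representable_convex_hull_UN:
  fixes S :: "'k \<Rightarrow> (real ^ 'n) set"
  assumes "finite K" and sdp: "\<And>k. k \<in> K \<Longrightarrow> sdp_representable (S k)"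
    and bdd: "\<And>k. k \<in> K \<Longrightarrow> bounded (S k)" and ne: "\<And>k. k \<in> K \<Longrightarrow> S k \<noteq> {}"
  shows "sdp_representable (convex hull (\<Union>k\<in>K. S k))"
proof -
  have "\<forall>k. \<exists>N d A0 A B. k \<in> K \<longrightarrow>
      sym_mat d A0 \<and> (\<forall>i. sym_mat d (A i)) \<and> (\<forall>j\<in>{1..N}. sym_mat d (B j)) \<and>
      S k = {x. \<exists>u. psd_mat d (pencil N A0 A B 1 (vec_nth x) u)}"
    using sdp unfolding sdp_representable_pencil by meson
  then obtain N d A0 A B where *: "\<And>k. k \<in> K \<Longrightarrow>
      sym_mat (d k) (A0 k) \<and> (\<forall>i. sym_mat (d k) (A k i)) \<and> (\<forall>j\<in>{1..N k}. sym_mat (d k) (B k j)) \<and>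
      S k = {x. \<exists>u. psd_mat (d k) (pencil (N k) (A0 k) (A k) (B k) 1 (vec_nth x) u)}"
    by metis
  define P where "P k = pencil (N k) (A0 k) (A k) (B k)" for k
  have S: "S k = {x. \<exists>u. psd_mat (d k) (P k 1 (vec_nth x) u)}" if "k \<in> K" for k
    using *[OF that] unfolding P_def by simp
  have P_add: "psd_mat (d k) (P k (a + a') (\<lambda>i. y i + y' i) (\<lambda>j. u j + u' j))"
    if "psd_mat (d k) (P k a y u)" "psd_mat (d k) (P k a' y' u')" for k a a' y y' u u'
    using psd_mat_pencil_add that unfolding P_def by blast
  have P_scale: "psd_mat (d k) (P k (c * a) (\<lambda>i. c * y i) (\<lambda>j. c * u j))"
    if "psd_mat (d k) (P k a y u)" "0 \<le> c" for k c a y u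
    using psd_mat_pencil_scale that unfolding P_def by blast
  have recession: "y = (\<lambda>i. 0)" if k: "k \<in> K" and psd: "psd_mat (d k) (P k 0 y u)" for k y u
  proof (rule ccontr)
    assume "y \<noteq> (\<lambda>i. 0)"
    define v where "v = (\<chi> i. y i)"
    have "v \<noteq> 0" using \<open>y \<noteq> (\<lambda>i. 0)\<close> by (auto simp: v_def vec_eq_iff)
    obtain s us where s: "psd_mat (d k) (P k 1 (vec_nth s) us)" using ne[OF k] S[OF k] by auto
    have "s + t *\<^sub>R v \<in> S k" if "t \<ge> 0" for t
    proof -
      have "vec_nth (s + t *\<^sub>R v) = (\<lambda>i. s $ i + t * y i)"
        by (simp add: v_def fun_eq_iff)
      then have "psd_mat (d k) (P k 1 (vec_nth (s + t *\<^sub>R v)) (\<lambda>j. us j + t * u j))"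
        using P_add[OF s P_scale[OF psd that]] by simp
      then show ?thesis using S[OF k] by blast
    qed
    moreover obtain r where r: "\<And>x. x \<in> S k \<Longrightarrow> norm x \<le> r"
      using bdd[OF k] unfolding bounded_iff by blast
    \<comment> \<open>Long enough that \<open>s + t *\<^sub>R v\<close> leaves the ball of radius
      \<open>r\<close> around 0.\<close>
    moreover define t where "t = (\<bar>r\<bar> + norm s + 1) / norm v"
    ultimately have "norm (s + t *\<^sub>R v) \<le> r" by auto
    moreover have "norm (t *\<^sub>R v) = \<bar>r\<bar> + norm s + 1"
      using \<open>v \<noteq> 0\<close> by (simp add: t_def)
    moreover have "norm (t *\<^sub>R v) \<le> norm (s + t *\<^sub>R v) + norm s"
      using norm_triangle_ineq4[of "s + t *\<^sub>R v" s] by simp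
    ultimately show False by linarith
  qed
  \<comment> \<open>For each \<open>k\<close>, the index \<open>None\<close> holds the weight,
    \<open>Inl i\<close> coordinate \<open>i\<close> of the weighted point and \<open>Inr j\<close>
    the weighted lifting variable \<open>j\<close>. Taking the union over all \<open>k\<close> makes
    \<open>V\<close> a plain product.\<close>
  define J :: "('n + nat) option set"
    where "J = insert None (Some ` (range Inl \<union> Inr ` (\<Union>k\<in>K. {1..N k})))"
  define V where "V = K \<times> J"
  have "finite V" using \<open>finite K\<close> by (auto simp: V_def J_def)
  have V: "(k, None) \<in> V" "(k, Some (Inl i)) \<in> V" "j \<in> {1..N k} \<Longrightarrow> (k, Some (Inr j)) \<in> V"
    if "k \<in> K" for k i j using that unfolding V_def J_def by blast+
  let ?C = "\<lambda>x v. (\<forall>k\<in>K. 0 \<le> v (k, None) \<and>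
       psd_mat (d k) (P k (v (k, None)) (\<lambda>i. v (k, Some (Inl i))) (\<lambda>j. v (k, Some (Inr j))))) \<and>
     (\<Sum>k\<in>K. v (k, None)) = 1 \<and> (\<forall>i\<in>UNIV. x $ i = (\<Sum>k\<in>K. v (k, Some (Inl i))))"
  have "lmi V ?C"
    unfolding P_def using V \<open>finite V\<close> \<open>finite K\<close> *
    by (intro lmi_conj lmi_ball lmi_nonneg lmi_eq lmi_pencil affine_form_intros) auto
  then have "sdp_representable {x. \<exists>v. ?C x v}"
    using \<open>finite V\<close> by (rule sdp_representable_lmi[rotated])
  also have "{x. \<exists>v. ?C x v} = {\<Sum>k\<in>K. c k *\<^sub>R s k |c s.
      (\<forall>k\<in>K. 0 \<le> c k) \<and> sum c K = 1 \<and> (\<forall>k\<in>K. s k \<in> S k)}"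
  proof (intro equalityI subsetI)
    fix x assume "x \<in> {x. \<exists>v. ?C x v}"
    then obtain v where v: "?C x v" by blast
    have "\<exists>s\<in>S k. \<forall>i. v (k, Some (Inl i)) = v (k, None) * s $ i" if k: "k \<in> K" for k
    proof (cases "v (k, None) = 0")
      \<comment> \<open>A zero weight forces the weighted point to be 0, so any element of
        \<open>S k\<close> serves.\<close>
      case True
      then have "(\<lambda>i. v (k, Some (Inl i))) = (\<lambda>i. 0)" using recession[OF k] v k by auto
      then show ?thesis using True ne[OF k] by (metis ex_in_conv mult_zero_left)
    next
      case False
      then have pos: "v (k, None) > 0" using v k by (simp add: less_le)
      let ?c = "1 / v (k, None)"
      have "psd_mat (d k) (P k (v (k, None)) (\<lambda>i. v (k, Some (Inl i))) (\<lambda>j. v (k, Some (Inr j))))"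
        using v k by blast
      from P_scale[OF this, of ?c]
      have "psd_mat (d k) (P k 1 (vec_nth (\<chi> i. ?c * v (k, Some (Inl i))))
          (\<lambda>j. ?c * v (k, Some (Inr j))))"
        using pos by (simp add: vec_lambda_inverse)
      then have "(\<chi> i. ?c * v (k, Some (Inl i))) \<in> S k" using S[OF k] by blast
      then show ?thesis using pos by (intro bexI) auto
    qed
    then obtain s where s: "\<And>k. k \<in> K \<Longrightarrow> s k \<in> S k"
      "\<And>k i. k \<in> K \<Longrightarrow> v (k, Some (Inl i)) = v (k, None) * s k $ i" by metis
    have "x = (\<Sum>k\<in>K. v (k, None) *\<^sub>R s k)"
      using v s(2) by (simp add: vec_eq_iff)
    then show "x \<in> {\<Sum>k\<in>K. c k *\<^sub>R s k |c s.
      (\<forall>k\<in>K. 0 \<le> c k) \<and> sum c K = 1 \<and> (\<forall>k\<in>K. s k \<in> S k)}"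
      using v s(1) by (auto intro!: exI[of _ "\<lambda>k. v (k, None)"] exI[of _ s])
  next
    fix x assume "x \<in> {\<Sum>k\<in>K. c k *\<^sub>R s k |c s.
      (\<forall>k\<in>K. 0 \<le> c k) \<and> sum c K = 1 \<and> (\<forall>k\<in>K. s k \<in> S k)}"
    then obtain c s where cs: "x = (\<Sum>k\<in>K. c k *\<^sub>R s k)" "\<And>k. k \<in> K \<Longrightarrow> 0 \<le> c k" "sum c K = 1"
      "\<And>k. k \<in> K \<Longrightarrow> s k \<in> S k" by blast
    have "\<forall>k. \<exists>u. k \<in> K \<longrightarrow> psd_mat (d k) (P k 1 (vec_nth (s k)) u)"
      using cs(4) S by blast
    then obtain u where u: "\<And>k. k \<in> K \<Longrightarrow> psd_mat (d k) (P k 1 (vec_nth (s k)) (u k))" by metis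
    define v where "v = (\<lambda>(k, r). case r of None \<Rightarrow> c k | Some (Inl i) \<Rightarrow> c k * s k $ i
      | Some (Inr j) \<Rightarrow> c k * u k j)"
    have "psd_mat (d k) (P k (c k) (\<lambda>i. c k * s k $ i) (\<lambda>j. c k * u k j))" if "k \<in> K" for k
      using P_scale[OF u[OF that] cs(2)[OF that]] by simp
    then have "?C x v" using cs by (simp add: v_def)
    then show "x \<in> {x. \<exists>v. ?C x v}" by blast
  qed
  also have "\<dots> = convex hull (\<Union>k\<in>K. S k)"
    using convex_hull_finite_union[OF \<open>finite K\<close>, of S] ne sdp convex_sdp_representable by auto
  finally show ?thesis .
qed

section \<open>Polynomials of bounded degree\<close>

text \<open>This is the space of polynomial functions of total degree at most the given number. The
  Horner-like recursion supports induction on the bound without a degree function.\<close>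

primrec polys_upto :: "nat \<Rightarrow> (real ^ 'n \<Rightarrow> real) set" where
  "polys_upto 0 = range (\<lambda>c x. c)"
| "polys_upto (Suc D) = {\<lambda>x. c + (\<Sum>i\<in>UNIV. x $ i * p i x) |c p. \<forall>i. p i \<in> polys_upto D}"

lemma polys_upto_SucI:
  assumes "\<And>i. p i \<in> polys_upto D" "\<And>x. q x = c + (\<Sum>i\<in>UNIV. x $ i * p i x)"
  shows "q \<in> polys_upto (Suc D)"
proof -
  have "q = (\<lambda>x. c + (\<Sum>i\<in>UNIV. x $ i * p i x))" using assms(2) by (rule ext)
  then show ?thesis using assms(1) by auto
qed

lemma polys_upto_SucE:
  assumes "q \<in> polys_upto (Suc D)"
  obtains c p where "\<And>i. p i \<in> polys_upto D" "q = (\<lambda>x. c + (\<Sum>i\<in>UNIV. x $ i * p i x))"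
  using assms by auto

declare polys_upto.simps(2) [simp del]

lemma polys_upto_const: "(\<lambda>x. c) \<in> polys_upto D"
proof (induction D arbitrary: c)
  case (Suc D)
  then show ?case by (intro polys_upto_SucI[of "\<lambda>i x. 0" D _ c]) auto
qed auto

lemma polys_upto_Suc: "p \<in> polys_upto D \<Longrightarrow> p \<in> polys_upto (Suc D)"
proof (induction D arbitrary: p)
  case 0
  then obtain c where "p = (\<lambda>x. c)" by auto
  then show ?case using polys_upto_const[of c "Suc 0"] by (simp only:)
next
  case (Suc D)
  obtain c q where "\<And>i. q i \<in> polys_upto D"
    "p = (\<lambda>x. c + (\<Sum>i\<in>UNIV. x $ i * q i x))"
    using polys_upto_SucE[OF Suc.prems] by blast
  then show ?case using Suc.IH by (intro polys_upto_SucI[of q "Suc D" p c]) auto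
qed

lemma polys_upto_mono: "D \<le> E \<Longrightarrow> p \<in> polys_upto D \<Longrightarrow> p \<in> polys_upto E"
  by (induction E rule: dec_induct) (simp_all add: polys_upto_Suc)

lemma polys_upto_add:
  "p \<in> polys_upto D \<Longrightarrow> q \<in> polys_upto D \<Longrightarrow> (\<lambda>x. p x + q x) \<in> polys_upto D"
proof (induction D arbitrary: p q)
  case (Suc D)
  obtain c p' where p: "\<And>i. p' i \<in> polys_upto D" "p = (\<lambda>x. c + (\<Sum>i\<in>UNIV. x $ i * p' i x))"
    using polys_upto_SucE[OF Suc.prems(1)] by blast
  obtain d q' where q: "\<And>i. q' i \<in> polys_upto D" "q = (\<lambda>x. d + (\<Sum>i\<in>UNIV. x $ i * q' i x))"
    using polys_upto_SucE[OF Suc.prems(2)] by blast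
  show ?case
    using Suc.IH[OF p(1) q(1)]
    by (intro polys_upto_SucI[of "\<lambda>i x. p' i x + q' i x" D _ "c + d"])
       (auto simp: p(2) q(2) distrib_left sum.distrib)
qed auto

lemma polys_upto_scale: "p \<in> polys_upto D \<Longrightarrow> (\<lambda>x. a * p x) \<in> polys_upto D"
proof (induction D arbitrary: p)
  case (Suc D)
  obtain c p' where p: "\<And>i. p' i \<in> polys_upto D" "p = (\<lambda>x. c + (\<Sum>i\<in>UNIV. x $ i * p' i x))"
    using polys_upto_SucE[OF Suc.prems] by blast
  show ?case
    using Suc.IH[OF p(1)]
    by (intro polys_upto_SucI[of "\<lambda>i x. a * p' i x" D _ "a * c"])
       (auto simp: p(2) distrib_left sum_distrib_left mult_ac)
qed auto

lemma polys_upto_diff: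
  "p \<in> polys_upto D \<Longrightarrow> q \<in> polys_upto D \<Longrightarrow> (\<lambda>x. p x - q x) \<in> polys_upto D"
  using polys_upto_add[of p D "\<lambda>x. -1 * q x"] polys_upto_scale[of q D "-1"] by simp

lemma polys_upto_sum:
  "(\<And>k. k \<in> K \<Longrightarrow> p k \<in> polys_upto D) \<Longrightarrow> (\<lambda>x. \<Sum>k\<in>K. p k x) \<in> polys_upto D"
  by (induction K rule: infinite_finite_induct) (simp_all add: polys_upto_const polys_upto_add)

lemma polys_upto_coord_mult:
  fixes p :: "real ^ 'n \<Rightarrow> real"
  assumes "p \<in> polys_upto D"
  shows "(\<lambda>x. x $ k * p x) \<in> polys_upto (Suc D)"
  using assms polys_upto_const[of 0 D]
  by (intro polys_upto_SucI[of "\<lambda>i. if i = k then p else (\<lambda>x. 0)" D _ 0])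
     (auto simp: if_distrib if_distribR cong: if_cong)

lemma polys_upto_coord: "(\<lambda>x. x $ k) \<in> polys_upto (Suc D)"
  using polys_upto_coord_mult[OF polys_upto_const[of 1 D], of k] by simp

lemma polys_upto_mult:
  "p \<in> polys_upto D \<Longrightarrow> q \<in> polys_upto E \<Longrightarrow> (\<lambda>x. p x * q x) \<in> polys_upto (D + E)"
proof (induction D arbitrary: p)
  case 0
  then show ?case by (auto intro: polys_upto_scale)
next
  case (Suc D)
  obtain c p' where p: "\<And>i. p' i \<in> polys_upto D" "p = (\<lambda>x. c + (\<Sum>i\<in>UNIV. x $ i * p' i x))"
    using polys_upto_SucE[OF Suc.prems(1)] by blast
  have "(\<lambda>x. c * q x + (\<Sum>i\<in>UNIV. x $ i * (p' i x * q x))) \<in> polys_upto (Suc (D + E))"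
    using Suc.IH[OF p(1) Suc.prems(2)] Suc.prems(2)
    by (intro polys_upto_add polys_upto_sum polys_upto_coord_mult polys_upto_scale)
       (auto intro: polys_upto_mono[rotated])
  then show ?case
    by (simp add: p(2) distrib_right sum_distrib_right mult.assoc)
qed

lemma polys_upto_mult_le:
  "p \<in> polys_upto D \<Longrightarrow> q \<in> polys_upto E \<Longrightarrow> D + E \<le> G \<Longrightarrow> (\<lambda>x. p x * q x) \<in> polys_upto G"
  using polys_upto_mult polys_upto_mono by blast

text \<open>The homothety with centre \<open>a\<close> is affine, so substituting it does not raise
  the degree. Jensen's inequality evaluates polynomials along segments starting at
  \<open>a\<close>.\<close>

lemma polys_upto_line:
  "p \<in> polys_upto D \<Longrightarrow> (\<lambda>x. p (a + t *\<^sub>R (x - a))) \<in> polys_upto D"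
proof (induction D arbitrary: p)
  case 0
  then show ?case by auto
next
  case (Suc D)
  obtain c p' where p: "\<And>i. p' i \<in> polys_upto D" "p = (\<lambda>x. c + (\<Sum>i\<in>UNIV. x $ i * p' i x))"
    using polys_upto_SucE[OF Suc.prems] by blast
  \<comment> \<open>Coordinate \<open>i\<close> of \<open>a + t *\<^sub>R (x - a)\<close> is split
    as \<open>(a $ i - t * a $ i) + t * x $ i\<close>.\<close>
  have "(\<lambda>x. c + (\<Sum>i\<in>UNIV. (a $ i - t * a $ i) * p' i (a + t *\<^sub>R (x - a))
      + t * (x $ i * p' i (a + t *\<^sub>R (x - a))))) \<in> polys_upto (Suc D)"
    using Suc.IH[OF p(1)]
    by (intro polys_upto_add polys_upto_sum polys_upto_const polys_upto_coord_mult polys_upto_scale)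
       (auto intro: polys_upto_Suc)
  then show ?case
    by (simp add: p(2) algebra_simps)
qed

lemma polys_upto_coord_diff: "(\<lambda>x. x $ i - a) \<in> polys_upto (Suc D)"
  by (intro polys_upto_diff polys_upto_coord polys_upto_const)

lemma bounded_linear_vec_expansion:
  fixes f :: "real ^ 'n \<Rightarrow> real"
  assumes "bounded_linear f"
  shows "f x = (\<Sum>i\<in>UNIV. x $ i * f (axis i 1))"
proof -
  have "f x = f (\<Sum>i\<in>UNIV. x $ i *\<^sub>R axis i 1)"
    using basis_expansion[of x] by (simp add: scalar_mult_eq_scaleR)
  then show ?thesis
    using assms by (simp add: linear_sum linear_cmul bounded_linear.linear)
qed

lemma real_polynomial_function_polys_upto:
  fixes p :: "real ^ 'n \<Rightarrow> real"
  assumes "real_polynomial_function p"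
  shows "\<exists>D. p \<in> polys_upto D"
  using assms
proof (induction p rule: real_polynomial_function.induct)
  case (linear f)
  have "f x = 0 + (\<Sum>i\<in>UNIV. x $ i * f (axis i 1))" for x
    using bounded_linear_vec_expansion[OF linear, of x] by simp
  then have "f \<in> polys_upto (Suc 0)"
    by (intro polys_upto_SucI[of "\<lambda>i x. f (axis i 1)" 0 f 0] polys_upto_const)
  then show ?case by blast
next
  case (const c)
  then show ?case using polys_upto_const by blast
next
  case (add f g)
  then obtain D E where "f \<in> polys_upto D" "g \<in> polys_upto E" by blast
  then show ?case
    using polys_upto_add[of f "max D E" g] polys_upto_mono[of D "max D E"]
      polys_upto_mono[of E "max D E"] by auto
next
  case (mult f g)
  then show ?case using polys_upto_mult by blast
qed

section \<open>Monomials and interpolation at finitely many points\<close>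

definition monomial :: "'n list \<Rightarrow> real ^ 'n \<Rightarrow> real" where
  "monomial is x = (\<Prod>i\<leftarrow>is. x $ i)"

lemma monomial_polys_upto: "monomial is \<in> polys_upto (length is)"
proof (induction "is")
  case Nil
  then show ?case using polys_upto_const[of 1 0] by (simp add: monomial_def[abs_def])
next
  case (Cons i "is")
  then show ?case
    using polys_upto_coord_mult[of "monomial is" "length is" i]
    by (simp add: monomial_def[abs_def])
qed

lemma finite_lists_upto: "finite {is :: 'n::finite list. length is \<le> D}"
  using finite_lists_length_le[of "UNIV :: 'n set" D] by (simp add: finite_class.finite_UNIV)

text \<open>Monomials are indexed by words, so unfolding the recursion of \<open>polys_upto\<close>
  prepends one letter per step. Different words may name the same monomial, but only their span
  matters.\<close>

lemma polys_upto_monomial_span: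
  fixes p :: "real ^ 'n \<Rightarrow> real"
  assumes "p \<in> polys_upto D"
  shows "\<exists>c. \<forall>x. p x = (\<Sum>is | length is \<le> D. c is * monomial is x)"
  using assms
proof (induction D arbitrary: p)
  case 0
  then obtain c where "p = (\<lambda>x. c)" by auto
  then show ?case by (intro exI[of _ "\<lambda>_. c"]) (simp add: monomial_def)
next
  case (Suc D)
  obtain c p' where p: "\<And>i. p' i \<in> polys_upto D" "p = (\<lambda>x. c + (\<Sum>i\<in>UNIV. x $ i * p' i x))"
    using polys_upto_SucE[OF Suc.prems] by blast
  have "\<forall>i. \<exists>e. \<forall>x. p' i x = (\<Sum>is | length is \<le> D. e is * monomial is x)"
    using Suc.IH[OF p(1)] by blast
  then obtain e where e: "\<And>i x. p' i x = (\<Sum>is | length is \<le> D. e i is * monomial is x)" by metis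
  \<comment> \<open>The empty word carries the constant term; a word \<open>i # is\<close> carries
    the coefficient of \<open>is\<close> in the factor multiplying \<open>x $ i\<close>.\<close>
  define e' where "e' js = (case js of [] \<Rightarrow> c | i # is \<Rightarrow> e i is)" for js
  have split: "{js :: 'n list. length js \<le> Suc D} =
      insert [] ((\<lambda>(i, is). i # is) ` (UNIV \<times> {is. length is \<le> D}))"
  proof (intro equalityI subsetI)
    fix js :: "'n list" assume "js \<in> {js. length js \<le> Suc D}"
    then show "js \<in> insert [] ((\<lambda>(i, is). i # is) ` (UNIV \<times> {is. length is \<le> D}))"
      by (cases js) auto
  qed auto
  have "p x = (\<Sum>js | length js \<le> Suc D. e' js * monomial js x)" for x
  proof -
    have "(\<Sum>js | length js \<le> Suc D. e' js * monomial js x) = c +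
        (\<Sum>(i, is)\<in>UNIV \<times> {is. length is \<le> D}. e i is * (x $ i * monomial is x))"
      unfolding split
      by (subst sum.insert)
         (auto simp: sum.reindex inj_on_def e'_def monomial_def finite_lists_upto
           case_prod_unfold intro!: finite_imageI finite_cartesian_product)
    also have "\<dots> = p x"
      by (simp add: p(2) e sum.cartesian_product[symmetric] sum_distrib_left mult_ac)
    finally show ?thesis by simp
  qed
  then show ?case by blast
qed

text \<open>
  Linear functionals on a finite-dimensional space of functions are represented by signed weights on
  finitely many points. This gives the lifting variables of the moment relaxation without choosing
  a basis of the polynomial space.
\<close>

lemma finite_point_interpolation:
  fixes v :: "'j \<Rightarrow> 'a \<Rightarrow> real"
  assumes "finite J"
  shows "\<exists>F. finite F \<and> (\<forall>x. \<exists>w. \<forall>j\<in>J. v j x = (\<Sum>y\<in>F. w y * v j y))"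
  using assms
proof (induction J rule: finite_induct)
  case empty
  then show ?case by auto
next
  case (insert k J)
  then obtain F where F: "finite F" "\<And>x. \<exists>w. \<forall>j\<in>J. v j x = (\<Sum>y\<in>F. w y * v j y)" by blast
  obtain w0 where w0: "\<And>x j. j \<in> J \<Longrightarrow> v j x = (\<Sum>y\<in>F. w0 x y * v j y)" using F(2) by metis
  \<comment> \<open>The weights vanish outside \<open>F\<close>, so that a further point can be
    added to the sums without changing them; \<open>r\<close> is the error that they make on the new
    function \<open>v k\<close>.\<close>
  define w where "w x y = (if y \<in> F then w0 x y else 0)" for x y
  define r where "r x = v k x - (\<Sum>y\<in>F. w x y * v k y)" for x
  have wJ: "v j x = (\<Sum>y\<in>F. w x y * v j y)" if "j \<in> J" for j x
    using w0[OF that, of x] unfolding w_def by simp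
  show ?case
  proof (cases "\<forall>x. r x = 0")
    case True
    then have "\<forall>x. \<forall>j\<in>insert k J. v j x = (\<Sum>y\<in>F. w x y * v j y)"
      using wJ True unfolding r_def by (metis eq_iff_diff_eq_0 insert_iff)
    then show ?thesis using F(1) by blast
  next
    case False
    then obtain x0 where x0: "r x0 \<noteq> 0" by blast
    have w: "(\<Sum>y\<in>insert x0 F. w x y * g y) = (\<Sum>y\<in>F. w x y * g y)" for x g
      using F(1) by (intro sum.mono_neutral_right) (auto simp: w_def)
    \<comment> \<open>The unit mass at \<open>x0\<close> minus \<open>w x0\<close> annihilates every
      \<open>v j\<close> with \<open>j \<in> J\<close> and has the value
      \<open>r x0 \<noteq> 0\<close> on \<open>v k\<close>. Adding its multiple by
      \<open>r x / r x0\<close> therefore corrects the error on \<open>v k\<close> alone.\<close>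
    have "v j x = (\<Sum>y\<in>insert x0 F. (w x y + r x / r x0 * ((if y = x0 then 1 else 0) - w x0 y)) * v j y)"
      if "j \<in> insert k J" for x j
    proof -
      have "(\<Sum>y\<in>insert x0 F. (w x y + r x / r x0 * ((if y = x0 then 1 else 0) - w x0 y)) * v j y) =
          (\<Sum>y\<in>insert x0 F. w x y * v j y) + r x / r x0 *
          ((\<Sum>y\<in>insert x0 F. (if y = x0 then 1 else 0) * v j y) - (\<Sum>y\<in>insert x0 F. w x0 y * v j y))"
        by (simp only: distrib_right left_diff_distrib mult.assoc sum.distrib sum_subtractf
            sum_distrib_left right_diff_distrib)
      also have "(\<Sum>y\<in>insert x0 F. (if y = x0 then 1 else 0) * v j y) = v j x0"
        using F(1) by (simp add: if_distrib[of "\<lambda>c. c * _"] cong: if_cong)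
      also have "(\<Sum>y\<in>insert x0 F. w x y * v j y) + r x / r x0 *
          (v j x0 - (\<Sum>y\<in>insert x0 F. w x0 y * v j y)) = v j x"
      proof (cases "j = k")
        case True
        have "v k x0 - (\<Sum>y\<in>F. w x0 y * v k y) = r x0"
          "(\<Sum>y\<in>F. w x y * v k y) + r x = v k x" by (simp_all add: r_def)
        then show ?thesis unfolding w True using x0 by simp
      next
        case False
        then have "(\<Sum>y\<in>F. w z y * v j y) = v j z" for z
          using wJ[of j z] that by auto
        then show ?thesis unfolding w by simp
      qed
      finally show ?thesis by simp
    qed
    then show ?thesis using F(1) by (intro exI[of _ "insert x0 F"]) (auto intro!: exI)
  qed
qed

text \<open>Interpolating the finitely many monomials suffices, because both sides are linear in
  \<open>p\<close>.\<close>

lemma polys_upto_point_interpolation: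
  "\<exists>F. finite F \<and> (\<forall>x :: real ^ 'n. \<exists>w. \<forall>p\<in>polys_upto D. p x = (\<Sum>y\<in>F. w y * p y))"
proof -
  obtain F :: "(real ^ 'n) set" where F: "finite F"
    "\<And>x. \<exists>w. \<forall>is\<in>{is. length is \<le> D}. monomial is x = (\<Sum>y\<in>F. w y * monomial is y)"
    using finite_point_interpolation[OF finite_lists_upto[of D], of monomial] by blast
  have "\<exists>w. \<forall>p\<in>polys_upto D. p x = (\<Sum>y\<in>F. w y * p y)" for x
  proof -
    obtain w where w: "\<And>is. length is \<le> D \<Longrightarrow> monomial is x = (\<Sum>y\<in>F. w y * monomial is y)"
      using F(2)[of x] by blast
    have "p x = (\<Sum>y\<in>F. w y * p y)" if p: "p \<in> polys_upto D" for p
    proof -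
      obtain c where c: "\<And>x. p x = (\<Sum>is | length is \<le> D. c is * monomial is x)"
        using polys_upto_monomial_span[OF p] by blast
      have "p x = (\<Sum>is | length is \<le> D. c is * (\<Sum>y\<in>F. w y * monomial is y))"
        unfolding c[of x] using w by (intro sum.cong) auto
      also have "\<dots> = (\<Sum>y\<in>F. w y * p y)"
        unfolding c sum_distrib_left by (subst sum.swap) (simp add: mult_ac)
      finally show ?thesis .
    qed
    then show ?thesis by blast
  qed
  then show ?thesis using F(1) by blast
qed

section \<open>Derivatives of polynomials and Jensen's inequality\<close>

text \<open>The partial derivatives are produced as polynomials, so that the statement can be
  applied again to reach the Hessian.\<close>

lemma real_polynomial_function_has_gradient:
  fixes p :: "real ^ 'n \<Rightarrow> real"
  assumes "real_polynomial_function p"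
  shows "\<exists>G. (\<forall>i. real_polynomial_function (G i)) \<and>
    (\<forall>x. (p has_derivative (\<lambda>v. \<Sum>i\<in>UNIV. v $ i * G i x)) (at x))"
  using assms
proof (induction p rule: real_polynomial_function.induct)
  case (linear f)
  then have "f = (\<lambda>x. \<Sum>i\<in>UNIV. x $ i * f (axis i 1))"
    using bounded_linear_vec_expansion by blast
  moreover have "(f has_derivative f) (at x)" for x
    using linear by (rule bounded_linear_imp_has_derivative)
  ultimately show ?case
    by (intro exI[of _ "\<lambda>i x. f (axis i 1)"]) auto
next
  case (const c)
  then show ?case by (intro exI[of _ "\<lambda>i x. 0"]) auto
next
  case (add f g)
  then obtain G H where "\<And>i. real_polynomial_function (G i)" "\<And>i. real_polynomial_function (H i)"
    "\<And>x. (f has_derivative (\<lambda>v. \<Sum>i\<in>UNIV. v $ i * G i x)) (at x)"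
    "\<And>x. (g has_derivative (\<lambda>v. \<Sum>i\<in>UNIV. v $ i * H i x)) (at x)" by blast
  then show ?case
    by (intro exI[of _ "\<lambda>i x. G i x + H i x"])
       (auto simp: distrib_left sum.distrib intro: has_derivative_add)
next
  case (mult f g)
  then obtain G H where GH: "\<And>i. real_polynomial_function (G i)" "\<And>i. real_polynomial_function (H i)"
    "\<And>x. (f has_derivative (\<lambda>v. \<Sum>i\<in>UNIV. v $ i * G i x)) (at x)"
    "\<And>x. (g has_derivative (\<lambda>v. \<Sum>i\<in>UNIV. v $ i * H i x)) (at x)" by blast
  have "((\<lambda>x. f x * g x) has_derivative (\<lambda>v. \<Sum>i\<in>UNIV. v $ i * (f x * H i x + G i x * g x))) (at x)" for x
    using has_derivative_mult[OF GH(3,4), of x]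
    by (simp add: distrib_left sum.distrib sum_distrib_left sum_distrib_right mult_ac)
  moreover have "real_polynomial_function (\<lambda>x. f x * H i x + G i x * g x)" for i
    using GH(1,2) mult.hyps
    by (intro real_polynomial_function.intros(3,4))
  ultimately show ?case by (intro exI[of _ "\<lambda>i x. f x * H i x + G i x * g x"]) auto
qed

lemma partial_deriv_eqI:
  fixes p :: "real ^ 'n \<Rightarrow> real"
  assumes "(p has_derivative (\<lambda>v. \<Sum>i\<in>UNIV. v $ i * G i)) (at x)"
  shows "partial_deriv i p x = G i"
proof -
  have "(p has_derivative (\<lambda>v. \<Sum>i\<in>UNIV. v $ i * G i)) (at (x + 0 *\<^sub>R axis i 1))"
    using assms by simp
  moreover have "((\<lambda>t. x + t *\<^sub>R axis i 1) has_derivative (\<lambda>t. t *\<^sub>R axis i 1)) (at 0)"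
    by (auto intro!: derivative_eq_intros)
  ultimately have "((\<lambda>t. p (x + t *\<^sub>R axis i 1)) has_derivative
      (\<lambda>t. \<Sum>j\<in>UNIV. (t *\<^sub>R axis i 1 :: real ^ 'n) $ j * G j)) (at 0)"
    using has_derivative_compose by blast
  moreover have "(\<lambda>t. \<Sum>j\<in>UNIV. (t *\<^sub>R axis i 1 :: real ^ 'n) $ j * G j) = (*) (G i)"
    by (simp add: fun_eq_iff axis_def if_distrib if_distribR mult.commute cong: if_cong)
  ultimately have "((\<lambda>t. p (x + t *\<^sub>R axis i 1)) has_field_derivative G i) (at 0)"
    by (simp add: has_field_derivative_def)
  then show ?thesis unfolding partial_deriv_def by (rule DERIV_imp_deriv)
qed

lemma has_derivative_partial_deriv:
  fixes p :: "real ^ 'n \<Rightarrow> real"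
  assumes "real_polynomial_function p"
  shows "(p has_derivative (\<lambda>v. \<Sum>i\<in>UNIV. v $ i * partial_deriv i p x)) (at x)"
proof -
  obtain G where "\<And>x. (p has_derivative (\<lambda>v. \<Sum>i\<in>UNIV. v $ i * G i x)) (at x)"
    using real_polynomial_function_has_gradient[OF assms] by blast
  then show ?thesis using partial_deriv_eqI[of p "\<lambda>i. G i x" x] by simp
qed

lemma real_polynomial_function_partial_deriv:
  fixes p :: "real ^ 'n \<Rightarrow> real"
  assumes "real_polynomial_function p"
  shows "real_polynomial_function (partial_deriv i p)"
proof -
  obtain G where G: "\<And>i. real_polynomial_function (G i)"
    "\<And>x. (p has_derivative (\<lambda>v. \<Sum>i\<in>UNIV. v $ i * G i x)) (at x)"
    using real_polynomial_function_has_gradient[OF assms] by blast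
  then have "partial_deriv i p = G i" using partial_deriv_eqI[OF G(2)] by (intro ext)
  then show ?thesis using G(1) by simp
qed

lemma has_field_derivative_along_line:
  fixes p :: "real ^ 'n \<Rightarrow> real"
  assumes "real_polynomial_function p"
  shows "((\<lambda>t. p (a + t *\<^sub>R v)) has_field_derivative
    (\<Sum>i\<in>UNIV. v $ i * partial_deriv i p (a + t *\<^sub>R v))) (at t)"
proof -
  have "((\<lambda>t. a + t *\<^sub>R v) has_derivative (\<lambda>s. s *\<^sub>R v)) (at t)"
    by (auto intro!: derivative_eq_intros)
  from has_derivative_compose[OF this has_derivative_partial_deriv[OF assms]]
  show ?thesis
    unfolding has_field_derivative_def
    by (rule has_derivative_eq_rhs) (simp add: fun_eq_iff sum_distrib_left sum_distrib_right mult_ac)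
qed

text \<open>Jensen's inequality: in the proof, \<open>\<phi> 0\<close> is \<open>g a\<close> and
  \<open>\<phi> 1\<close> is the weighted sum of \<open>g\<close>. Since the weights may be
  negative, concavity of \<open>g\<close> alone would not give the bound; \<open>neg\<close> asks
  directly for a nonpositive second derivative of \<open>\<phi>\<close>.\<close>

lemma weighted_sum_le_barycenter:
  fixes g :: "real ^ 'n \<Rightarrow> real"
  assumes g: "real_polynomial_function g"
    and w: "sum w F = 1" and a: "a = (\<Sum>y\<in>F. w y *\<^sub>R y)"
    and neg: "\<And>t. 0 \<le> t \<Longrightarrow> t \<le> 1 \<Longrightarrow> (\<Sum>y\<in>F. w y * (\<Sum>i\<in>UNIV. \<Sum>j\<in>UNIV.
      (y - a) $ i * (y - a) $ j * partial_deriv i (partial_deriv j g) (a + t *\<^sub>R (y - a)))) \<le> 0"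
  shows "(\<Sum>y\<in>F. w y * g y) \<le> g a"
proof -
  define \<phi> where "\<phi> t = (\<Sum>y\<in>F. w y * g (a + t *\<^sub>R (y - a)))" for t
  define \<phi>' where "\<phi>' t = (\<Sum>y\<in>F. w y * (\<Sum>j\<in>UNIV. (y - a) $ j * partial_deriv j g (a + t *\<^sub>R (y - a))))" for t
  define \<phi>'' where "\<phi>'' t = (\<Sum>y\<in>F. w y * (\<Sum>i\<in>UNIV. \<Sum>j\<in>UNIV.
      (y - a) $ i * (y - a) $ j * partial_deriv i (partial_deriv j g) (a + t *\<^sub>R (y - a))))" for t
  have d1: "(\<phi> has_field_derivative \<phi>' t) (at t)" for t
    unfolding \<phi>_def[abs_def] \<phi>'_def
    by (intro DERIV_sum DERIV_cmult has_field_derivative_along_line g)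
  have d2: "(\<phi>' has_field_derivative \<phi>'' t) (at t)" for t
  proof -
    have "(\<phi>' has_field_derivative (\<Sum>y\<in>F. w y * (\<Sum>j\<in>UNIV. (y - a) $ j *
        (\<Sum>i\<in>UNIV. (y - a) $ i * partial_deriv i (partial_deriv j g) (a + t *\<^sub>R (y - a)))))) (at t)"
      unfolding \<phi>'_def[abs_def]
      by (intro DERIV_sum DERIV_cmult has_field_derivative_along_line
          real_polynomial_function_partial_deriv g)
    also have "(\<Sum>y\<in>F. w y * (\<Sum>j\<in>UNIV. (y - a) $ j *
        (\<Sum>i\<in>UNIV. (y - a) $ i * partial_deriv i (partial_deriv j g) (a + t *\<^sub>R (y - a))))) = \<phi>'' t"
      unfolding \<phi>''_def sum_distrib_left by (subst (2) sum.swap) (simp add: mult_ac)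
    finally show ?thesis .
  qed
  \<comment> \<open>At \<open>t = 0\<close> the gradient is taken at \<open>a\<close> for every
    \<open>y\<close>, so it factors out and leaves the centred first moments, which vanish because
    \<open>a\<close> is the barycenter.\<close>
  have "\<phi>' 0 = (\<Sum>j\<in>UNIV. partial_deriv j g a * (\<Sum>y\<in>F. w y * (y - a) $ j))"
    unfolding \<phi>'_def sum_distrib_left by (subst sum.swap) (simp add: mult_ac)
  moreover have "(\<Sum>y\<in>F. w y * (y - a) $ j) = 0" for j
  proof -
    have "(\<Sum>y\<in>F. w y * (y - a) $ j) = (\<Sum>y\<in>F. w y * y $ j) - sum w F * a $ j"
      by (simp add: right_diff_distrib sum_subtractf sum_distrib_right)
    then show ?thesis using w a by simp
  qed
  ultimately have "\<phi>' 0 = 0" by simp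
  have "\<phi>' t \<le> 0" if "0 \<le> t" "t \<le> 1" for t
  proof -
    have "\<phi>' t \<le> \<phi>' 0"
    proof (rule DERIV_nonpos_imp_nonincreasing[OF that(1)])
      fix s assume "0 \<le> s" "s \<le> t"
      then have "\<phi>'' s \<le> 0" unfolding \<phi>''_def using that(2) by (intro neg) auto
      then show "\<exists>y. (\<phi>' has_field_derivative y) (at s) \<and> y \<le> 0" using d2 by blast
    qed
    then show ?thesis using \<open>\<phi>' 0 = 0\<close> by simp
  qed
  then have "\<phi> 1 \<le> \<phi> 0"
    using DERIV_nonpos_imp_nonincreasing[of 0 1 \<phi>] d1 by fastforce
  then show ?thesis using w by (simp add: \<phi>_def sum_distrib_right[symmetric])
qed

section \<open>The moment relaxation on a ball\<close>

definition weighted_sum :: "'a set \<Rightarrow> ('a \<Rightarrow> real) \<Rightarrow> ('a \<Rightarrow> real) \<Rightarrow> real" where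
  "weighted_sum F w p = (\<Sum>y\<in>F. w y * p y)"

lemma weighted_sum_add:
  "weighted_sum F w (\<lambda>y. p y + q y) = weighted_sum F w p + weighted_sum F w q"
  by (simp add: weighted_sum_def distrib_left sum.distrib)

lemma weighted_sum_diff:
  "weighted_sum F w (\<lambda>y. p y - q y) = weighted_sum F w p - weighted_sum F w q"
  by (simp add: weighted_sum_def right_diff_distrib sum_subtractf)

lemma weighted_sum_scale: "weighted_sum F w (\<lambda>y. c * p y) = c * weighted_sum F w p"
  by (simp add: weighted_sum_def sum_distrib_left mult_ac)

lemma weighted_sum_sum:
  "weighted_sum F w (\<lambda>y. \<Sum>k\<in>K. p k y) = (\<Sum>k\<in>K. weighted_sum F w (p k))"
  unfolding weighted_sum_def sum_distrib_left by (rule sum.swap)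

text \<open>
  The functional \<open>L\<close> of the moment relaxation is \<open>weighted_sum F w\<close>, with weights of arbitrary
  sign, and \<open>psd_weights F w D b\<close> says that its localizing matrix for \<open>b\<close> in degree \<open>D\<close> is positive
  semidefinite.
\<close>

definition psd_weights ::
  "(real ^ 'n) set \<Rightarrow> (real ^ 'n \<Rightarrow> real) \<Rightarrow> nat \<Rightarrow> (real ^ 'n \<Rightarrow> real) \<Rightarrow> bool" where
  "psd_weights F w D b \<longleftrightarrow> (\<forall>q\<in>polys_upto D. 0 \<le> weighted_sum F w (\<lambda>y. b y * (q y)\<^sup>2))"

lemma psd_weights_square:
  "psd_weights F w D (\<lambda>y. 1) \<Longrightarrow> q \<in> polys_upto D \<Longrightarrow> 0 \<le> weighted_sum F w (\<lambda>y. (q y)\<^sup>2)"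
  unfolding psd_weights_def by simp

text \<open>For \<open>q\<close> with coefficient vector \<open>z\<close>, the weighted sum of
  \<open>b * q\<^sup>2\<close> is a quadratic form in \<open>z\<close> whose matrix, the localizing
  matrix \<open>?M\<close>, is linear in \<open>w\<close>. As the words span
  \<open>polys_upto D\<close>, every \<open>q\<close> is reached.\<close>

lemma lmi_psd_weights:
  fixes F :: "(real ^ 'n) set"
  assumes "finite F"
  shows "lmi F (\<lambda>x w. psd_weights F w D b)"
proof -
  let ?I = "{is :: 'n list. length is \<le> D}"
  let ?M = "\<lambda>k l x w. \<Sum>y\<in>F. w y * (b y * (monomial k y * monomial l y))"
  have eq: "(\<Sum>k\<in>?I. \<Sum>l\<in>?I. z k * ?M k l x w * z l) =
      weighted_sum F w (\<lambda>y. b y * (\<Sum>k\<in>?I. z k * monomial k y)\<^sup>2)" for z w x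
  proof -
    have "weighted_sum F w (\<lambda>y. b y * (\<Sum>k\<in>?I. z k * monomial k y)\<^sup>2) =
        weighted_sum F w (\<lambda>y. \<Sum>k\<in>?I. \<Sum>l\<in>?I. z k * (z l * (b y * (monomial k y * monomial l y))))"
      by (simp add: power2_eq_square sum_product sum_distrib_left mult_ac)
    also have "\<dots> = (\<Sum>k\<in>?I. \<Sum>l\<in>?I. z k * (z l *
        weighted_sum F w (\<lambda>y. b y * (monomial k y * monomial l y))))"
      by (simp only: weighted_sum_sum weighted_sum_scale)
    finally show ?thesis by (simp add: weighted_sum_def mult_ac)
  qed
  have "lmi F (\<lambda>x w. \<forall>z. 0 \<le> (\<Sum>k\<in>?I. \<Sum>l\<in>?I. z k * ?M k l x w * z l))"
    using assms finite_lists_upto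
    by (intro lmi_psd_form affine_form_sum affine_form_scale_right affine_form_var)
       (auto simp: mult_ac)
  moreover have "(\<forall>z. 0 \<le> (\<Sum>k\<in>?I. \<Sum>l\<in>?I. z k * ?M k l x w * z l)) \<longleftrightarrow> psd_weights F w D b"
    for x w
    unfolding eq
  proof
    assume L: "\<forall>z. 0 \<le> weighted_sum F w (\<lambda>y. b y * (\<Sum>k\<in>?I. z k * monomial k y)\<^sup>2)"
    show "psd_weights F w D b"
      unfolding psd_weights_def
    proof
      fix q :: "real ^ 'n \<Rightarrow> real" assume "q \<in> polys_upto D"
      then obtain c where "\<And>x. q x = (\<Sum>k\<in>?I. c k * monomial k x)"
        using polys_upto_monomial_span by blast
      then have "q = (\<lambda>y. \<Sum>k\<in>?I. c k * monomial k y)" by blast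
      then show "0 \<le> weighted_sum F w (\<lambda>y. b y * (q y)\<^sup>2)" using L by blast
    qed
  next
    assume R: "psd_weights F w D b"
    have "(\<lambda>y. \<Sum>k\<in>?I. z k * monomial k y) \<in> polys_upto D" for z
      using monomial_polys_upto
      by (intro polys_upto_sum polys_upto_scale) (auto intro: polys_upto_mono)
    then show "\<forall>z. 0 \<le> weighted_sum F w (\<lambda>y. b y * (\<Sum>k\<in>?I. z k * monomial k y)\<^sup>2)"
      by (intro allI bspec[OF R[unfolded psd_weights_def]])
  qed
  ultimately show ?thesis by simp
qed

section \<open>The ball constraint and exactness of the relaxation\<close>

definition ball_poly :: "real ^ 'n \<Rightarrow> real \<Rightarrow> real ^ 'n \<Rightarrow> real" where
  "ball_poly u \<delta> x = \<delta>\<^sup>2 - (norm (x - u))\<^sup>2"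

lemma ball_poly_nonneg: "0 \<le> \<delta> \<Longrightarrow> 0 \<le> ball_poly u \<delta> x \<longleftrightarrow> x \<in> cball u \<delta>"
  by (simp add: ball_poly_def dist_norm norm_minus_commute power2_le_iff_abs_le)

lemma norm_sq_sum: "(norm (x :: real ^ 'n))\<^sup>2 = (\<Sum>i\<in>UNIV. (x $ i)\<^sup>2)"
  unfolding power2_norm_eq_inner inner_vec_def by (simp add: power2_eq_square)

lemma ball_poly_polys_upto: "ball_poly u \<delta> \<in> polys_upto 2"
proof -
  have "ball_poly u \<delta> = (\<lambda>x. \<delta>\<^sup>2 - (\<Sum>i\<in>UNIV. (x $ i - u $ i) * (x $ i - u $ i)))"
    unfolding ball_poly_def norm_sq_sum by (simp add: fun_eq_iff power2_eq_square)
  moreover have "(\<lambda>x. \<delta>\<^sup>2 - (\<Sum>i\<in>UNIV. (x $ i - u $ i) * (x $ i - u $ i))) \<in> polys_upto 2"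
    by (intro polys_upto_diff polys_upto_const polys_upto_sum
        polys_upto_mult_le[OF polys_upto_coord_diff[of _ _ 0] polys_upto_coord_diff[of _ _ 0]]) simp
  ultimately show ?thesis by (simp only:)
qed

text \<open>An explicit form of concavity: for \<open>0 \<le> t \<le> 1\<close> the value at
  \<open>a\<close>, the value at \<open>y\<close> and a sum of squares enter with nonnegative
  coefficients. It carries the ball condition from \<open>y\<close> to the segment from
  \<open>a\<close> to \<open>y\<close>.\<close>

lemma ball_poly_line:
  "ball_poly u \<delta> (a + t *\<^sub>R (y - a)) = (1 - t) * ball_poly u \<delta> a + t * ball_poly u \<delta> y
    + t * (1 - t) * (\<Sum>i\<in>UNIV. (y $ i - a $ i)\<^sup>2)"
proof -
  define p q where "p = a - u" and "q = y - a"
  have "a + t *\<^sub>R (y - a) - u = p + t *\<^sub>R q" "y - u = p + q" "a - u = p"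
    by (simp_all add: p_def q_def)
  moreover have "(\<Sum>i\<in>UNIV. (y $ i - a $ i)\<^sup>2) = q \<bullet> q"
    unfolding q_def power2_norm_eq_inner[symmetric] norm_sq_sum by simp
  ultimately show ?thesis
    unfolding ball_poly_def power2_norm_eq_inner
    by (simp add: inner_add_left inner_add_right inner_commute[of q p] algebra_simps power2_eq_square)
qed

text \<open>This is the condition \<open>neg\<close> of Jensen's inequality, required uniformly: the
  degree of the relaxation is fixed before its weights and barycenter are known.\<close>

definition hessian_certificate :: "(real ^ 'n \<Rightarrow> real) \<Rightarrow> real ^ 'n \<Rightarrow> real \<Rightarrow> bool" where
  "hessian_certificate g u \<delta> \<longleftrightarrow> (\<exists>D0. \<forall>D\<ge>D0. \<forall>F w a t.
    psd_weights F w D (\<lambda>y. 1) \<longrightarrow> psd_weights F w D (ball_poly u \<delta>) \<longrightarrow>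
    0 \<le> ball_poly u \<delta> a \<longrightarrow> 0 \<le> t \<longrightarrow> t \<le> 1 \<longrightarrow>
    0 \<le> weighted_sum F w (\<lambda>y. \<Sum>i\<in>UNIV. \<Sum>j\<in>UNIV. (y - a) $ i * (y - a) $ j *
      - partial_deriv i (partial_deriv j g) (a + t *\<^sub>R (y - a))))"

text \<open>Feasible weights have their barycenter in the set by Jensen's inequality; conversely,
  evaluation at a point of the set is a feasible functional.\<close>

lemma sdp_representable_superlevel_ball:
  fixes g :: "real ^ 'n \<Rightarrow> real"
  assumes g: "real_polynomial_function g" and cert: "hessian_certificate g u \<delta>"
  shows "sdp_representable {x. 0 \<le> g x \<and> 0 \<le> ball_poly u \<delta> x}"
proof -
  obtain D0 where D0: "\<forall>D\<ge>D0. \<forall>F w a t.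
      psd_weights F w D (\<lambda>y. 1) \<longrightarrow> psd_weights F w D (ball_poly u \<delta>) \<longrightarrow>
      0 \<le> ball_poly u \<delta> a \<longrightarrow> 0 \<le> t \<longrightarrow> t \<le> 1 \<longrightarrow>
      0 \<le> weighted_sum F w (\<lambda>y. \<Sum>i\<in>UNIV. \<Sum>j\<in>UNIV. (y - a) $ i * (y - a) $ j *
        - partial_deriv i (partial_deriv j g) (a + t *\<^sub>R (y - a)))"
    using cert unfolding hessian_certificate_def by (elim exE) (rule that)
  obtain Dg where Dg: "g \<in> polys_upto Dg" using real_polynomial_function_polys_upto[OF g] by blast
  \<comment> \<open>\<open>Suc\<close> ensures that the linear polynomials
    \<open>y $ i - a $ i\<close> may be squared.\<close>
  define D where "D = Suc D0"
  \<comment> \<open>Large enough for \<open>g\<close>, the coordinates and the products of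
    \<open>ball_poly u \<delta>\<close> with squares from degree \<open>D\<close>.\<close>
  define E where "E = Dg + (2 + (D + D))"
  obtain F :: "(real ^ 'n) set" where F: "finite F"
    "\<And>x. \<exists>w. \<forall>p\<in>polys_upto E. p x = (\<Sum>y\<in>F. w y * p y)"
    using polys_upto_point_interpolation[of E] by blast
  let ?C = "\<lambda>x w. psd_weights F w D (\<lambda>y. 1) \<and> psd_weights F w D (ball_poly u \<delta>) \<and>
    (\<Sum>y\<in>F. w y) = 1 \<and> (\<forall>i\<in>UNIV. x $ i = (\<Sum>y\<in>F. w y * y $ i)) \<and> 0 \<le> (\<Sum>y\<in>F. w y * g y)"
  have "lmi F ?C"
    using F(1)
    by (intro lmi_conj lmi_ball lmi_eq lmi_nonneg lmi_psd_weights affine_form_intros) auto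
  then have "sdp_representable {x. \<exists>w. ?C x w}"
    using F(1) by (rule sdp_representable_lmi[rotated])
  also have "{x. \<exists>w. ?C x w} = {x. 0 \<le> g x \<and> 0 \<le> ball_poly u \<delta> x}"
  proof (intro Collect_cong iffI)
    fix a assume "\<exists>w. ?C a w"
    then obtain w where w: "?C a w" by blast
    have a: "a = (\<Sum>y\<in>F. w y *\<^sub>R y)" using w by (simp add: vec_eq_iff)
    have one: "weighted_sum F w (\<lambda>y. c) = c" for c
      using w by (simp add: weighted_sum_def sum_distrib_right[symmetric])
    have coord: "weighted_sum F w (\<lambda>y. y $ i) = a $ i" for i
      using w by (simp add: weighted_sum_def)
    \<comment> \<open>Expand \<open>ball_poly u \<delta>\<close> around \<open>a\<close>: the linear
      terms have weighted sum 0 and the quadratic ones contribute a nonpositive amount. So the value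
      at \<open>a\<close> is at least the weighted sum, which is nonnegative by the localizing
      condition for \<open>q = 1\<close>.\<close>
    have ball: "0 \<le> ball_poly u \<delta> a"
    proof -
      have "0 \<le> weighted_sum F w (ball_poly u \<delta>)"
        using w polys_upto_const[of 1 D] unfolding psd_weights_def by force
      also have "ball_poly u \<delta> = (\<lambda>y. ball_poly u \<delta> a - (\<Sum>i\<in>UNIV. (y $ i - a $ i)\<^sup>2)
          - (\<Sum>i\<in>UNIV. 2 * (a $ i - u $ i) * (y $ i - a $ i)))"
      proof
        fix y
        have "(y $ i - u $ i)\<^sup>2 = (a $ i - u $ i)\<^sup>2 + (y $ i - a $ i)\<^sup>2
            + 2 * (a $ i - u $ i) * (y $ i - a $ i)" for i
          by (simp add: power2_eq_square algebra_simps)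
        then show "ball_poly u \<delta> y = ball_poly u \<delta> a - (\<Sum>i\<in>UNIV. (y $ i - a $ i)\<^sup>2)
          - (\<Sum>i\<in>UNIV. 2 * (a $ i - u $ i) * (y $ i - a $ i))"
          unfolding ball_poly_def norm_sq_sum by (simp add: sum.distrib)
      qed
      also have "weighted_sum F w \<dots> = ball_poly u \<delta> a - (\<Sum>i\<in>UNIV. weighted_sum F w (\<lambda>y. (y $ i - a $ i)\<^sup>2))"
        by (simp add: weighted_sum_diff weighted_sum_sum weighted_sum_scale one coord)
      also have "\<dots> \<le> ball_poly u \<delta> a"
        using w by (auto simp: D_def intro!: sum_nonneg psd_weights_square[of F w D] intro: polys_upto_coord_diff)
      finally show ?thesis .
    qed
    have "weighted_sum F w (\<lambda>y. \<Sum>i\<in>UNIV. \<Sum>j\<in>UNIV. (y - a) $ i * (y - a) $ j *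
        - partial_deriv i (partial_deriv j g) (a + t *\<^sub>R (y - a))) \<ge> 0" if "0 \<le> t" "t \<le> 1" for t
      using w ball that by (intro D0[rule_format, of D]) (auto simp: D_def)
    then have "(\<Sum>y\<in>F. w y * g y) \<le> g a"
      using w a
      by (intro weighted_sum_le_barycenter g) (auto simp: weighted_sum_def sum_negf)
    then show "0 \<le> g a \<and> 0 \<le> ball_poly u \<delta> a" using w ball by linarith
  next
    fix a assume a: "0 \<le> g a \<and> 0 \<le> ball_poly u \<delta> a"
    \<comment> \<open>These weights reproduce evaluation at \<open>a\<close> up to degree
      \<open>E\<close>, so each condition in \<open>?C\<close> becomes a statement about values at
      \<open>a\<close>.\<close>
    obtain w where w: "\<And>p. p \<in> polys_upto E \<Longrightarrow> (\<Sum>y\<in>F. w y * p y) = p a"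
      using F(2)[of a] by metis
    have sq: "(\<lambda>y. (q y)\<^sup>2) \<in> polys_upto (D + D)" if "q \<in> polys_upto D" for q :: "real ^ 'n \<Rightarrow> real"
      unfolding power2_eq_square using polys_upto_mult[OF that that] .
    have "psd_weights F w D (\<lambda>y. 1)"
      unfolding psd_weights_def weighted_sum_def
    proof
      fix q :: "real ^ 'n \<Rightarrow> real" assume "q \<in> polys_upto D"
      then have "(\<lambda>y. 1 * (q y)\<^sup>2) \<in> polys_upto E"
        using polys_upto_mono[OF _ sq, of E q] by (simp add: E_def)
      from w[OF this] show "0 \<le> (\<Sum>y\<in>F. w y * (1 * (q y)\<^sup>2))" by simp
    qed
    moreover have "psd_weights F w D (ball_poly u \<delta>)"
      unfolding psd_weights_def weighted_sum_def
    proof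
      fix q :: "real ^ 'n \<Rightarrow> real" assume "q \<in> polys_upto D"
      then have "(\<lambda>y. ball_poly u \<delta> y * (q y)\<^sup>2) \<in> polys_upto E"
        by (intro polys_upto_mult_le[OF ball_poly_polys_upto sq]) (simp_all add: E_def)
      from w[OF this] show "0 \<le> (\<Sum>y\<in>F. w y * (ball_poly u \<delta> y * (q y)\<^sup>2))" using a by simp
    qed
    moreover have "(\<Sum>y\<in>F. w y) = 1" using w[OF polys_upto_const[of 1]] by simp
    moreover have coordE: "(\<lambda>y. y $ i) \<in> polys_upto E" for i
      unfolding E_def by (simp add: polys_upto_coord)
    have "\<forall>i\<in>UNIV. a $ i = (\<Sum>y\<in>F. w y * y $ i)" using w[OF coordE] by simp
    moreover have "g \<in> polys_upto E" using Dg by (rule polys_upto_mono[rotated]) (simp add: E_def)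
    then have "0 \<le> (\<Sum>y\<in>F. w y * g y)" using w a by simp
    ultimately show "\<exists>w. ?C a w" by blast
  qed
  finally show ?thesis .
qed

text \<open>Along the segment the Hessian form of \<open>- g\<close> in direction
  \<open>y - a\<close> is the squared length of \<open>W\<close> applied to \<open>y - a\<close>, a
  sum of squares of polynomials \<open>q k\<close> in \<open>y\<close>.\<close>

lemma sos_concave_hessian_certificate:
  fixes g :: "real ^ 'n \<Rightarrow> real"
  assumes "sos_concave g"
  shows "hessian_certificate g u \<delta>"
proof -
  obtain r W where W: "\<forall>k<r::nat. \<forall>j. real_polynomial_function (\<lambda>x. W x k j)"
    "\<forall>x i j. (- hessian g x) $ i $ j = (\<Sum>k<r. W x k i * W x k j)"
    using assms unfolding sos_concave_def by (elim exE conjE) (rule that)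
  have "\<forall>k j. \<exists>D. k < r \<longrightarrow> (\<lambda>x. W x k j) \<in> polys_upto D"
    using W(1) real_polynomial_function_polys_upto by metis
  then obtain d where d: "\<And>k j. k < r \<Longrightarrow> (\<lambda>x. W x k j) \<in> polys_upto (d k j)" by metis
  \<comment> \<open>A common bound for all entries of \<open>W\<close>; \<open>Suc\<close> accounts
    for the factor \<open>y $ i - a $ i\<close>.\<close>
  define D0 where "D0 = Suc (\<Sum>k<r. \<Sum>j\<in>UNIV. d k j)"
  have d_le: "d k j < D0" if "k < r" for k j
  proof -
    have "d k j \<le> (\<Sum>j\<in>UNIV. d k j)" by (rule member_le_sum) auto
    also have "\<dots> \<le> (\<Sum>k<r. \<Sum>j\<in>UNIV. d k j)"
      using that by (intro member_le_sum[of k "{..<r}" "\<lambda>k. \<Sum>j\<in>UNIV. d k j"]) auto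
    finally show ?thesis by (simp add: D0_def)
  qed
  show ?thesis
    unfolding hessian_certificate_def
  proof (intro exI[of _ D0] allI impI)
    fix D F w a and t :: real
    assume "D0 \<le> D" and psd: "psd_weights F w D (\<lambda>y :: real ^ 'n. 1)"
    define q where "q k y = (\<Sum>i\<in>UNIV. W (a + t *\<^sub>R (y - a)) k i * (y $ i - a $ i))" for k y
    have "q k \<in> polys_upto D" if "k < r" for k
      unfolding q_def[abs_def]
    proof (intro polys_upto_sum)
      fix i
      show "(\<lambda>y. W (a + t *\<^sub>R (y - a)) k i * (y $ i - a $ i)) \<in> polys_upto D"
        using d_le[OF that, of i] W(1) \<open>D0 \<le> D\<close>
        by (intro polys_upto_mult_le[OF polys_upto_line[OF d[OF that]] polys_upto_coord_diff[of _ _ 0]])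
           simp
    qed
    then have "0 \<le> (\<Sum>k<r. weighted_sum F w (\<lambda>y. (q k y)\<^sup>2))"
      by (intro sum_nonneg psd_weights_square[OF psd]) auto
    also have "\<dots> = weighted_sum F w (\<lambda>y. \<Sum>k<r. (q k y)\<^sup>2)" by (simp add: weighted_sum_sum)
    also have "(\<lambda>y. \<Sum>k<r. (q k y)\<^sup>2) = (\<lambda>y. \<Sum>i\<in>UNIV. \<Sum>j\<in>UNIV. (y - a) $ i * (y - a) $ j *
        - partial_deriv i (partial_deriv j g) (a + t *\<^sub>R (y - a)))"
    proof
      fix y
      have H: "- partial_deriv i (partial_deriv j g) x = (\<Sum>k<r. W x k i * W x k j)" for i j x
        using W(2)[rule_format, of x i j] by (simp add: hessian_def)
      show "(\<Sum>k<r. (q k y)\<^sup>2) = (\<Sum>i\<in>UNIV. \<Sum>j\<in>UNIV. (y - a) $ i * (y - a) $ j *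
        - partial_deriv i (partial_deriv j g) (a + t *\<^sub>R (y - a)))"
        unfolding H q_def power2_eq_square sum_product sum_distrib_left
        by (subst sum.swap, subst (2) sum.swap) (simp add: mult_ac sum_distrib_left)
    qed
    finally show "0 \<le> weighted_sum F w (\<lambda>y. \<Sum>i\<in>UNIV. \<Sum>j\<in>UNIV. (y - a) $ i * (y - a) $ j *
        - partial_deriv i (partial_deriv j g) (a + t *\<^sub>R (y - a)))" .
  qed
qed

section \<open>Certificates on small balls\<close>

text \<open>The elements are the sums \<open>\<sigma>0 + b * \<sigma>1\<close> with sums of squares
  \<open>\<sigma>0\<close> and \<open>\<sigma>1\<close>; the inductive form lets membership be
  exploited one generator at a time.\<close>

inductive_set quadratic_module :: "(real ^ 'n \<Rightarrow> real) \<Rightarrow> (real ^ 'n \<Rightarrow> real) set"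
  for b :: "real ^ 'n \<Rightarrow> real" where
  square: "real_polynomial_function q \<Longrightarrow> (\<lambda>x. (q x)\<^sup>2) \<in> quadratic_module b"
| weighted: "real_polynomial_function q \<Longrightarrow> (\<lambda>x. b x * (q x)\<^sup>2) \<in> quadratic_module b"
| add: "p \<in> quadratic_module b \<Longrightarrow> q \<in> quadratic_module b \<Longrightarrow> (\<lambda>x. p x + q x) \<in> quadratic_module b"

lemma quadratic_module_square_mult:
  assumes "p \<in> quadratic_module b" "real_polynomial_function h"
  shows "(\<lambda>x. (h x)\<^sup>2 * p x) \<in> quadratic_module b"
  using assms(1)
proof (induction p rule: quadratic_module.induct)
  case (square q)
  then have "(\<lambda>x. (h x * q x)\<^sup>2) \<in> quadratic_module b"
    using assms(2) by (intro quadratic_module.square real_polynomial_function.intros(4))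
  then show ?case by (simp add: power_mult_distrib)
next
  case (weighted q)
  then have "(\<lambda>x. b x * (h x * q x)\<^sup>2) \<in> quadratic_module b"
    using assms(2) by (intro quadratic_module.weighted real_polynomial_function.intros(4))
  then show ?case by (simp add: power_mult_distrib mult_ac)
next
  case (add p q)
  then show ?case by (simp add: distrib_left quadratic_module.add)
qed

lemma quadratic_module_scale:
  assumes "p \<in> quadratic_module b" "0 \<le> c"
  shows "(\<lambda>x. c * p x) \<in> quadratic_module b"
  using quadratic_module_square_mult[OF assms(1) real_polynomial_function.intros(2)[of "sqrt c"]] assms(2)
  by simp

lemma quadratic_module_const: "0 \<le> c \<Longrightarrow> (\<lambda>x. c) \<in> quadratic_module b"
  using quadratic_module.square[OF real_polynomial_function.intros(2)[of "sqrt c"]] by simp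

lemma quadratic_module_sum:
  assumes "\<And>k. k \<in> K \<Longrightarrow> p k \<in> quadratic_module b"
  shows "(\<lambda>x. \<Sum>k\<in>K. p k x) \<in> quadratic_module b"
  using assms
proof (induction K rule: infinite_finite_induct)
  case (insert k K)
  then show ?case by (simp add: quadratic_module.add)
qed (simp_all add: quadratic_module_const)

text \<open>Here \<open>p\<close> is evaluated on the segment and not at \<open>y\<close>.
  Substitution keeps squares, and \<open>ball_poly_line\<close> rewrites the generators weighted by
  the ball polynomial. The factor \<open>h\<close> will be a coordinate of \<open>y - a\<close> from
  the Hessian form.\<close>

lemma psd_weights_quadratic_module:
  fixes p :: "real ^ 'n \<Rightarrow> real"
  assumes "p \<in> quadratic_module (ball_poly u \<delta>)"
  shows "\<exists>D0. \<forall>D\<ge>D0. \<forall>F w a t h. psd_weights F w D (\<lambda>y. 1) \<longrightarrow>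
    psd_weights F w D (ball_poly u \<delta>) \<longrightarrow> 0 \<le> ball_poly u \<delta> a \<longrightarrow> 0 \<le> t \<longrightarrow> t \<le> 1 \<longrightarrow>
    h \<in> polys_upto 1 \<longrightarrow> 0 \<le> weighted_sum F w (\<lambda>y. p (a + t *\<^sub>R (y - a)) * (h y)\<^sup>2)"
  using assms
proof (induction p rule: quadratic_module.induct)
  case (square q)
  then obtain E where E: "q \<in> polys_upto E" using real_polynomial_function_polys_upto by blast
  show ?case
  proof (intro exI[of _ "Suc E"] allI impI)
    fix D F w and a :: "real ^ 'n" and h :: "real ^ 'n \<Rightarrow> real" and t :: real
    assume "Suc E \<le> D" and psd: "psd_weights F w D (\<lambda>y :: real ^ 'n. 1)" and h: "h \<in> polys_upto 1"
    then have "(\<lambda>y. q (a + t *\<^sub>R (y - a)) * h y) \<in> polys_upto D"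
      by (intro polys_upto_mult_le[OF polys_upto_line[OF E] h]) simp
    from psd_weights_square[OF psd this]
    show "0 \<le> weighted_sum F w (\<lambda>y. (q (a + t *\<^sub>R (y - a)))\<^sup>2 * (h y)\<^sup>2)"
      by (simp add: power_mult_distrib)
  qed
next
  case (weighted q)
  then obtain E where E: "q \<in> polys_upto E" using real_polynomial_function_polys_upto by blast
  show ?case
  \<comment> \<open>One degree is for \<open>h\<close>, the other for the factor
    \<open>y $ i - a $ i\<close> introduced by \<open>ball_poly_line\<close>.\<close>
  proof (intro exI[of _ "Suc (Suc E)"] allI impI)
    fix D F w and a :: "real ^ 'n" and h :: "real ^ 'n \<Rightarrow> real" and t :: real
    assume D: "Suc (Suc E) \<le> D" and psd: "psd_weights F w D (\<lambda>y. 1)"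
      and psd': "psd_weights F w D (ball_poly u \<delta>)"
      and a: "0 \<le> ball_poly u \<delta> a" and t: "0 \<le> t" "t \<le> 1" and h: "h \<in> polys_upto 1"
    define r where "r y = q (a + t *\<^sub>R (y - a)) * h y" for y
    have r: "r \<in> polys_upto (Suc E)"
      unfolding r_def[abs_def] by (intro polys_upto_mult_le[OF polys_upto_line[OF E] h]) simp
    have ri: "(\<lambda>y. (y $ i - a $ i) * r y) \<in> polys_upto D" for i
      using D by (intro polys_upto_mult_le[OF polys_upto_coord_diff[of _ _ 0] r]) simp
    have "r \<in> polys_upto D" using D r by (intro polys_upto_mono[OF _ r]) simp
    then have "0 \<le> weighted_sum F w (\<lambda>y. (r y)\<^sup>2)"
      "0 \<le> weighted_sum F w (\<lambda>y. ball_poly u \<delta> y * (r y)\<^sup>2)"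
      using psd_weights_square[OF psd] psd' unfolding psd_weights_def by blast+
    moreover have "0 \<le> (\<Sum>i\<in>UNIV. weighted_sum F w (\<lambda>y. ((y $ i - a $ i) * r y)\<^sup>2))"
      by (intro sum_nonneg psd_weights_square[OF psd] ri)
    ultimately have "0 \<le> (1 - t) * ball_poly u \<delta> a * weighted_sum F w (\<lambda>y. (r y)\<^sup>2)
        + t * weighted_sum F w (\<lambda>y. ball_poly u \<delta> y * (r y)\<^sup>2)
        + t * (1 - t) * (\<Sum>i\<in>UNIV. weighted_sum F w (\<lambda>y. ((y $ i - a $ i) * r y)\<^sup>2))"
      using a t by (intro add_nonneg_nonneg mult_nonneg_nonneg) auto
    also have "\<dots> = weighted_sum F w (\<lambda>y. (1 - t) * ball_poly u \<delta> a * (r y)\<^sup>2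
        + t * (ball_poly u \<delta> y * (r y)\<^sup>2) + t * (1 - t) * (\<Sum>i\<in>UNIV. ((y $ i - a $ i) * r y)\<^sup>2))"
      by (simp only: weighted_sum_add weighted_sum_scale weighted_sum_sum)
    also have "(\<lambda>y. (1 - t) * ball_poly u \<delta> a * (r y)\<^sup>2
        + t * (ball_poly u \<delta> y * (r y)\<^sup>2) + t * (1 - t) * (\<Sum>i\<in>UNIV. ((y $ i - a $ i) * r y)\<^sup>2)) =
        (\<lambda>y. ball_poly u \<delta> (a + t *\<^sub>R (y - a)) * (q (a + t *\<^sub>R (y - a)))\<^sup>2 * (h y)\<^sup>2)"
    proof
      fix y
      have sum: "(\<Sum>i\<in>UNIV. ((y $ i - a $ i) * r y)\<^sup>2) = (\<Sum>i\<in>UNIV. (y $ i - a $ i)\<^sup>2) * (r y)\<^sup>2"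
        by (simp add: power_mult_distrib sum_distrib_right)
      have r2: "(q (a + t *\<^sub>R (y - a)))\<^sup>2 * (h y)\<^sup>2 = (r y)\<^sup>2"
        by (simp add: r_def power_mult_distrib)
      show "(1 - t) * ball_poly u \<delta> a * (r y)\<^sup>2
        + t * (ball_poly u \<delta> y * (r y)\<^sup>2) + t * (1 - t) * (\<Sum>i\<in>UNIV. ((y $ i - a $ i) * r y)\<^sup>2) =
        ball_poly u \<delta> (a + t *\<^sub>R (y - a)) * (q (a + t *\<^sub>R (y - a)))\<^sup>2 * (h y)\<^sup>2"
        unfolding mult.assoc[of "ball_poly u \<delta> (a + t *\<^sub>R (y - a))"] r2 ball_poly_line sum
        by (simp only: distrib_right mult.assoc r2)
    qed
    finally show "0 \<le> weighted_sum F w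
        (\<lambda>y. ball_poly u \<delta> (a + t *\<^sub>R (y - a)) * (q (a + t *\<^sub>R (y - a)))\<^sup>2 * (h y)\<^sup>2)" .
  qed
next
  case (add p q)
  from add.IH(1) obtain D1 where D1: "\<forall>D\<ge>D1. \<forall>F w a t h. psd_weights F w D (\<lambda>y. 1) \<longrightarrow>
    psd_weights F w D (ball_poly u \<delta>) \<longrightarrow> 0 \<le> ball_poly u \<delta> a \<longrightarrow> 0 \<le> t \<longrightarrow> t \<le> 1 \<longrightarrow>
    h \<in> polys_upto 1 \<longrightarrow> 0 \<le> weighted_sum F w (\<lambda>y. p (a + t *\<^sub>R (y - a)) * (h y)\<^sup>2)"
    by (elim exE) (rule that)
  from add.IH(2) obtain D2 where D2: "\<forall>D\<ge>D2. \<forall>F w a t h. psd_weights F w D (\<lambda>y. 1) \<longrightarrow>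
    psd_weights F w D (ball_poly u \<delta>) \<longrightarrow> 0 \<le> ball_poly u \<delta> a \<longrightarrow> 0 \<le> t \<longrightarrow> t \<le> 1 \<longrightarrow>
    h \<in> polys_upto 1 \<longrightarrow> 0 \<le> weighted_sum F w (\<lambda>y. q (a + t *\<^sub>R (y - a)) * (h y)\<^sup>2)"
    by (elim exE) (rule that)
  show ?case
    unfolding distrib_right weighted_sum_add
    by (intro exI[of _ "max D1 D2"] allI impI add_nonneg_nonneg D1[rule_format] D2[rule_format])
       simp_all
qed

text \<open>An algebraic substitute for \<open>d\<close> tending to 0 at \<open>u\<close>: the bound
  on \<open>d\<^sup>2\<close> is witnessed by the quadratic module of every sufficiently small ball.
  Bounding the square instead of \<open>d\<close> makes sums and products easy.\<close>

definition locally_small :: "real ^ 'n \<Rightarrow> (real ^ 'n \<Rightarrow> real) \<Rightarrow> bool" where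
  "locally_small u d \<longleftrightarrow> real_polynomial_function d \<and>
    (\<forall>\<eta>>0. \<forall>\<^sub>F \<delta> in at_right 0. (\<lambda>x. \<eta> - (d x)\<^sup>2) \<in> quadratic_module (ball_poly u \<delta>))"

lemma real_polynomial_function_coord: "real_polynomial_function (\<lambda>x. x $ k)"
  by (intro real_polynomial_function.intros(1) bounded_linear_vec_nth)

lemma locally_small_coord: "locally_small u (\<lambda>x. x $ k - u $ k)"
  unfolding locally_small_def
proof (intro conjI allI impI)
  show "real_polynomial_function (\<lambda>x. x $ k - u $ k)" for k
    by (intro real_polynomial_function_diff real_polynomial_function_coord
        real_polynomial_function.intros(2))
  note poly = this
  fix \<eta> :: real assume \<eta>: "\<eta> > 0"
  have "(\<lambda>x. \<eta> - (x $ k - u $ k)\<^sup>2) \<in> quadratic_module (ball_poly u \<delta>)"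
    if "0 < \<delta>" "\<delta> < sqrt \<eta>" for \<delta>
  proof -
    have "\<delta>\<^sup>2 \<le> (sqrt \<eta>)\<^sup>2" using that by (intro power_mono) auto
    then have "0 \<le> \<eta> - \<delta>\<^sup>2" using \<eta> by simp
    \<comment> \<open>Adding the squares of the other coordinates to the ball polynomial leaves
      \<open>\<delta>\<^sup>2 - (x $ k - u $ k)\<^sup>2\<close>; the constant makes up the
      difference to \<open>\<eta>\<close>.\<close>
    then have "(\<lambda>x. (\<eta> - \<delta>\<^sup>2) + (ball_poly u \<delta> x * 1\<^sup>2 + (\<Sum>i\<in>UNIV - {k}. (x $ i - u $ i)\<^sup>2)))
        \<in> quadratic_module (ball_poly u \<delta>)"
      by (intro quadratic_module.add quadratic_module_const quadratic_module_sum
          quadratic_module.weighted quadratic_module.square poly real_polynomial_function.intros(2))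
    also have "(\<lambda>x. (\<eta> - \<delta>\<^sup>2) + (ball_poly u \<delta> x * 1\<^sup>2 + (\<Sum>i\<in>UNIV - {k}. (x $ i - u $ i)\<^sup>2))) =
        (\<lambda>x. \<eta> - (x $ k - u $ k)\<^sup>2)"
      unfolding ball_poly_def norm_sq_sum
      by (simp add: fun_eq_iff sum.remove[of UNIV k])
    finally show ?thesis .
  qed
  then show "\<forall>\<^sub>F \<delta> in at_right 0. (\<lambda>x. \<eta> - (x $ k - u $ k)\<^sup>2) \<in> quadratic_module (ball_poly u \<delta>)"
    using \<eta> by (intro eventually_at_rightI[of 0 "sqrt \<eta>"]) auto
qed

text \<open>By the parallelogram law, \<open>\<eta> - (d + e)\<^sup>2 = 2 * (\<eta> / 4 - d\<^sup>2)
  + 2 * (\<eta> / 4 - e\<^sup>2) + (d - e)\<^sup>2\<close>.\<close>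

lemma locally_small_add:
  assumes "locally_small u d" "locally_small u e"
  shows "locally_small u (\<lambda>x. d x + e x)"
  unfolding locally_small_def
proof (intro conjI allI impI)
  have poly: "real_polynomial_function d" "real_polynomial_function e"
    using assms unfolding locally_small_def by auto
  then show "real_polynomial_function (\<lambda>x. d x + e x)" by (rule real_polynomial_function.intros(3))
  fix \<eta> :: real assume "\<eta> > 0"
  then have "\<eta> / 4 > 0" by simp
  then have "\<forall>\<^sub>F \<delta> in at_right 0. (\<lambda>x. \<eta> / 4 - (d x)\<^sup>2) \<in> quadratic_module (ball_poly u \<delta>)"
    "\<forall>\<^sub>F \<delta> in at_right 0. (\<lambda>x. \<eta> / 4 - (e x)\<^sup>2) \<in> quadratic_module (ball_poly u \<delta>)"
    using assms unfolding locally_small_def by blast+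
  then show "\<forall>\<^sub>F \<delta> in at_right 0. (\<lambda>x. \<eta> - (d x + e x)\<^sup>2) \<in> quadratic_module (ball_poly u \<delta>)"
  proof eventually_elim
    case (elim \<delta>)
    then have "(\<lambda>x. 2 * (\<eta> / 4 - (d x)\<^sup>2) + (2 * (\<eta> / 4 - (e x)\<^sup>2) + (d x - e x)\<^sup>2))
        \<in> quadratic_module (ball_poly u \<delta>)"
      using poly by (intro quadratic_module.add quadratic_module_scale quadratic_module.square
          real_polynomial_function_diff) auto
    then show ?case by (simp add: power2_eq_square algebra_simps)
  qed
qed

text \<open>This rests on \<open>\<eta> - (d * e)\<^sup>2 = (\<eta> - e\<^sup>2) + e\<^sup>2 * (1 -
  d\<^sup>2)\<close>.\<close>

lemma locally_small_mult:
  assumes "locally_small u d" "locally_small u e"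
  shows "locally_small u (\<lambda>x. d x * e x)"
  unfolding locally_small_def
proof (intro conjI allI impI)
  have poly: "real_polynomial_function d" "real_polynomial_function e"
    using assms unfolding locally_small_def by auto
  then show "real_polynomial_function (\<lambda>x. d x * e x)" by (rule real_polynomial_function.intros(4))
  fix \<eta> :: real assume "\<eta> > 0"
  then have "\<forall>\<^sub>F \<delta> in at_right 0. (\<lambda>x. 1 - (d x)\<^sup>2) \<in> quadratic_module (ball_poly u \<delta>)"
    "\<forall>\<^sub>F \<delta> in at_right 0. (\<lambda>x. \<eta> - (e x)\<^sup>2) \<in> quadratic_module (ball_poly u \<delta>)"
    using assms zero_less_one unfolding locally_small_def by blast+
  then show "\<forall>\<^sub>F \<delta> in at_right 0. (\<lambda>x. \<eta> - (d x * e x)\<^sup>2) \<in> quadratic_module (ball_poly u \<delta>)"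
  proof eventually_elim
    case (elim \<delta>)
    then have "(\<lambda>x. (\<eta> - (e x)\<^sup>2) + (e x)\<^sup>2 * (1 - (d x)\<^sup>2)) \<in> quadratic_module (ball_poly u \<delta>)"
      using poly by (intro quadratic_module.add quadratic_module_square_mult) auto
    then show ?case by (simp add: power2_eq_square algebra_simps)
  qed
qed

lemma locally_small_scale:
  assumes "locally_small u d"
  shows "locally_small u (\<lambda>x. c * d x)"
  unfolding locally_small_def
proof (intro conjI allI impI)
  have poly: "real_polynomial_function d"
    using assms unfolding locally_small_def by auto
  then show "real_polynomial_function (\<lambda>x. c * d x)"
    by (intro real_polynomial_function.intros(2,4))
  fix \<eta> :: real assume \<eta>: "\<eta> > 0"
  \<comment> \<open>The \<open>+ 1\<close> avoids division by 0 and leaves the constant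
    \<open>s\<close> over in \<open>\<eta> = c\<^sup>2 * s + s\<close>.\<close>
  define s where "s = \<eta> / (c\<^sup>2 + 1)"
  have "c\<^sup>2 + 1 > 0" by (simp add: add_nonneg_pos)
  then have s0: "s > 0" "(c\<^sup>2 + 1) * s = \<eta>" using \<eta> by (simp_all add: s_def)
  then have s: "s > 0" "\<eta> = c\<^sup>2 * s + s" by (simp_all add: distrib_right)
  from s(1) have "\<forall>\<^sub>F \<delta> in at_right 0. (\<lambda>x. s - (d x)\<^sup>2) \<in> quadratic_module (ball_poly u \<delta>)"
    using assms unfolding locally_small_def by blast
  then show "\<forall>\<^sub>F \<delta> in at_right 0. (\<lambda>x. \<eta> - (c * d x)\<^sup>2) \<in> quadratic_module (ball_poly u \<delta>)"
  proof eventually_elim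
    case (elim \<delta>)
    then have "(\<lambda>x. s + c\<^sup>2 * (s - (d x)\<^sup>2)) \<in> quadratic_module (ball_poly u \<delta>)"
      using s(1) by (intro quadratic_module.add quadratic_module_scale quadratic_module_const) auto
    then show ?case by (simp add: s(2) power_mult_distrib algebra_simps)
  qed
qed

lemma locally_small_zero: "locally_small u (\<lambda>x. 0)"
  using locally_small_scale[OF locally_small_coord[of u], of 0] by simp

lemma locally_small_sum:
  "(\<And>k. k \<in> K \<Longrightarrow> locally_small u (d k)) \<Longrightarrow> locally_small u (\<lambda>x. \<Sum>k\<in>K. d k x)"
  by (induction K rule: infinite_finite_induct) (simp_all add: locally_small_zero locally_small_add)

text \<open>Induction on the polynomial; for a product, expand \<open>f x * g x\<close> around
  \<open>f u\<close> and \<open>g u\<close>, which leaves one product and two multiples of small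
  differences.\<close>

lemma locally_small_diff:
  fixes p :: "real ^ 'n \<Rightarrow> real"
  assumes "real_polynomial_function p"
  shows "locally_small u (\<lambda>x. p x - p u)"
  using assms
proof (induction p rule: real_polynomial_function.induct)
  case (linear f)
  have "f x - f u = (\<Sum>i\<in>UNIV. f (axis i 1) * (x $ i - u $ i))" for x
  proof -
    have "f x - f u = f (x - u)" using linear by (simp add: linear_diff bounded_linear.linear)
    then show ?thesis
      using bounded_linear_vec_expansion[OF linear, of "x - u"] by (simp add: mult.commute)
  qed
  then show ?case
    by (simp add: locally_small_sum locally_small_scale locally_small_coord)
next
  case (const c)
  then show ?case by (simp add: locally_small_zero)
next
  case (add f g)
  then show ?case using locally_small_add[OF add.IH] by (simp add: algebra_simps)
next
  case (mult f g)
  have "locally_small u (\<lambda>x. (f x - f u) * (g x - g u) + (f u * (g x - g u) + g u * (f x - f u)))"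
    using mult.IH by (intro locally_small_add locally_small_mult locally_small_scale)
  then show ?case by (simp add: algebra_simps)
qed

text \<open>Completing the square, as in the Cholesky decomposition.\<close>

lemma pos_def_sum_of_squares:
  fixes A :: "'a \<Rightarrow> 'a \<Rightarrow> real"
  assumes "finite I" "\<And>i j. i \<in> I \<Longrightarrow> j \<in> I \<Longrightarrow> A i j = A j i"
    and "\<And>z :: 'a \<Rightarrow> real. \<exists>i\<in>I. z i \<noteq> 0 \<Longrightarrow> 0 < (\<Sum>i\<in>I. \<Sum>j\<in>I. z i * A i j * z j)"
  shows "\<exists>(r::nat) W. \<forall>i\<in>I. \<forall>j\<in>I. A i j = (\<Sum>k<r. W k i * W k j)"
  using assms
proof (induction I arbitrary: A rule: finite_induct)
  case empty
  then show ?case by auto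
next
  case (insert p I)
  define a where "a = A p p"
  \<comment> \<open>The Schur complement of the pivot \<open>a\<close>: what remains of the form
    after completing the square in coordinate \<open>p\<close>.\<close>
  define A' where "A' i j = A i j - A p i * A p j / a" for i j
  have form: "(\<Sum>i\<in>insert p I. \<Sum>j\<in>insert p I. z i * A i j * z j) =
      z p * z p * a + 2 * z p * (\<Sum>i\<in>I. A p i * z i) + (\<Sum>i\<in>I. \<Sum>j\<in>I. z i * A i j * z j)"
    for z :: "'a \<Rightarrow> real"
  proof -
    have "(\<Sum>i\<in>I. z i * A i p * z p) = z p * (\<Sum>i\<in>I. A p i * z i)"
      unfolding sum_distrib_left using insert.prems(1) by (intro sum.cong) (auto simp: mult_ac)
    moreover have "(\<Sum>j\<in>I. z p * A p j * z j) = z p * (\<Sum>i\<in>I. A p i * z i)"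
      unfolding sum_distrib_left by (intro sum.cong) (auto simp: mult_ac)
    ultimately show ?thesis
      using insert.hyps by (simp add: sum.distrib a_def algebra_simps)
  qed
  have "0 < (\<Sum>i\<in>insert p I. \<Sum>j\<in>insert p I. (if i = p then 1 else 0) * A i j * (if j = p then 1 else 0))"
    by (rule insert.prems(2)) auto
  moreover have "(\<Sum>i\<in>I. A p i * (if i = p then 1 else 0)) = 0"
    "(\<Sum>i\<in>I. \<Sum>j\<in>I. (if i = p then 1 else 0) * A i j * (if j = p then 1 else 0)) = 0"
    using insert.hyps by (auto intro!: sum.neutral)
  ultimately have a: "a > 0" unfolding form by simp
  have "\<exists>(r::nat) W. \<forall>i\<in>I. \<forall>j\<in>I. A' i j = (\<Sum>k<r. W k i * W k j)"
  proof (rule insert.IH)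
    show "A' i j = A' j i" if "i \<in> I" "j \<in> I" for i j
      using insert.prems(1)[of i j] that by (simp add: A'_def)
    fix z :: "'a \<Rightarrow> real" assume z: "\<exists>i\<in>I. z i \<noteq> 0"
    define s where "s = (\<Sum>i\<in>I. A p i * z i)"
    \<comment> \<open>This value in coordinate \<open>p\<close> makes the completed square vanish,
      so the form of \<open>A\<close> at \<open>z'\<close> equals that of \<open>A'\<close> at
      \<open>z\<close>.\<close>
    define z' where "z' = z(p := - s / a)"
    have z'I: "z' i = z i" if "i \<in> I" for i using that insert.hyps by (auto simp: z'_def)
    have "0 < (\<Sum>i\<in>insert p I. \<Sum>j\<in>insert p I. z' i * A i j * z' j)"
      using z z'I by (intro insert.prems(2)) auto
    also have "\<dots> = (s / a) * (s / a) * a - 2 * (s / a) * s + (\<Sum>i\<in>I. \<Sum>j\<in>I. z i * A i j * z j)"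
      unfolding form s_def using z'I by (simp add: z'_def s_def cong: sum.cong)
    also have "\<dots> = (\<Sum>i\<in>I. \<Sum>j\<in>I. z i * A i j * z j) - s * s / a"
      using a by (simp add: field_simps)
    also have "s * s / a = (\<Sum>i\<in>I. \<Sum>j\<in>I. z i * (A p i * A p j / a) * z j)"
      unfolding s_def sum_product by (simp add: sum_divide_distrib mult_ac)
    finally show "0 < (\<Sum>i\<in>I. \<Sum>j\<in>I. z i * A' i j * z j)"
      by (simp add: A'_def algebra_simps sum_subtractf)
  qed
  then obtain r :: nat and W where W: "\<And>i j. i \<in> I \<Longrightarrow> j \<in> I \<Longrightarrow> A' i j = (\<Sum>k<r. W k i * W k j)"
    by blast
  \<comment> \<open>The new last row accounts for the completed square; the earlier rows get 0 in
    column \<open>p\<close>.\<close>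
  define W' where "W' k i = (if k < r then (if i = p then 0 else W k i) else A p i / sqrt a)" for k i
  have "A i j = (\<Sum>k<Suc r. W' k i * W' k j)" if ij: "i \<in> insert p I" "j \<in> insert p I" for i j
  proof -
    have "(\<Sum>k<Suc r. W' k i * W' k j) =
        (\<Sum>k<r. if i = p \<or> j = p then 0 else W k i * W k j) + A p i * A p j / a"
      using a by (auto simp: W'_def intro!: sum.cong)
    also have "\<dots> = A i j"
    proof (cases "i = p \<or> j = p")
      case True
      then show ?thesis using a insert.prems(1)[of i p] ij by (auto simp: a_def)
    next
      case False
      then show ?thesis using W[of i j] ij by (simp add: A'_def)
    qed
    finally show ?thesis by simp
  qed
  then show ?case by blast
qed

text \<open>At \<open>u\<close> the form of \<open>- hessian g\<close> exceeds
  \<open>\<epsilon>\<close> times the squared norm. Half of this margin is set aside, and the rest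
  of the form is a sum of squares of linear forms. The margin absorbs the deviation of the Hessian
  from its value at \<open>u\<close>, which is certifiably small on small balls.\<close>

lemma neg_def_hessian_certificate:
  fixes g :: "real ^ 'n \<Rightarrow> real"
  assumes g: "real_polynomial_function g"
    and neg: "\<And>v. v \<noteq> 0 \<Longrightarrow> v \<bullet> (hessian g u *v v) < 0"
  shows "\<forall>\<^sub>F \<delta> in at_right 0. hessian_certificate g u \<delta>"
proof -
  define H where "H i j x = - partial_deriv i (partial_deriv j g) x" for i j x
  have H: "real_polynomial_function (H i j)" for i j
    unfolding H_def[abs_def]
    by (intro real_polynomial_function_minus real_polynomial_function_partial_deriv g)
  define Q where "Q z = (\<Sum>i\<in>UNIV. \<Sum>j\<in>UNIV. z i * H i j u * z j)" for z :: "'n \<Rightarrow> real"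
  have Q: "Q (vec_nth v) = - (v \<bullet> (hessian g u *v v))" for v
    by (simp add: Q_def H_def inner_vec_def matrix_vector_mult_def hessian_def sum_distrib_left
        sum_negf mult_ac)
  have Q_scale: "Q (\<lambda>i. c * z i) = c\<^sup>2 * Q z" for c z
    by (simp add: Q_def sum_distrib_left power2_eq_square mult_ac)
  have cont: "continuous_on (sphere 0 1) (\<lambda>v. Q (vec_nth v))"
    unfolding Q_def by (intro continuous_intros)
  have "axis undefined 1 \<in> sphere (0 :: real ^ 'n) 1" by simp
  then have "sphere (0 :: real ^ 'n) 1 \<noteq> {}" by blast
  from continuous_attains_inf[OF compact_sphere this cont]
  obtain v0 where v0: "v0 \<in> sphere 0 1" "\<forall>v\<in>sphere 0 1. Q (vec_nth v0) \<le> Q (vec_nth v)"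
    by (elim bexE) (rule that)
  define \<epsilon> where "\<epsilon> = Q (vec_nth v0)"
  have "v0 \<noteq> 0" using v0(1) by auto
  then have "\<epsilon> > 0" using neg by (simp add: \<epsilon>_def Q)
  have Q_ge: "\<epsilon> * (\<Sum>i\<in>UNIV. (z i)\<^sup>2) \<le> Q z" for z
  proof -
    define v where "v = (\<chi> i. z i)"
    show ?thesis
    proof (cases "v = 0")
      case True
      then show ?thesis by (simp add: v_def vec_eq_iff Q_def)
    next
      case False
      then have "\<epsilon> \<le> Q (vec_nth (v /\<^sub>R norm v))"
        unfolding \<epsilon>_def by (intro v0(2)[rule_format]) simp
      also have "vec_nth (v /\<^sub>R norm v) = (\<lambda>i. inverse (norm v) * z i)"
        by (simp add: v_def fun_eq_iff)
      finally have "\<epsilon> * (norm v)\<^sup>2 \<le> Q z"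
        using False unfolding Q_scale by (simp add: field_simps)
      then show ?thesis by (simp add: norm_sq_sum v_def)
    qed
  qed
  \<comment> \<open>Symmetrized, with \<open>\<epsilon> / 2\<close> times the identity removed; by
    \<open>Q_ge\<close> the form remains positive definite.\<close>
  define A where "A i j = (H i j u + H j i u) / 2 - (if i = j then \<epsilon> / 2 else 0)" for i j
  have A: "Q z = (\<Sum>i\<in>UNIV. \<Sum>j\<in>UNIV. z i * A i j * z j) + \<epsilon> / 2 * (\<Sum>i\<in>UNIV. (z i)\<^sup>2)" for z
  proof -
    have "(\<Sum>i\<in>UNIV. \<Sum>j\<in>UNIV. z i * A i j * z j) =
        (\<Sum>i\<in>UNIV. \<Sum>j\<in>UNIV. z i * H i j u * z j) / 2 + (\<Sum>i\<in>UNIV. \<Sum>j\<in>UNIV. z i * H j i u * z j) / 2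
        - (\<Sum>i\<in>UNIV. \<Sum>j\<in>UNIV. if i = j then z i * (\<epsilon> / 2) * z i else 0)"
      unfolding sum_divide_distrib sum.distrib[symmetric] sum_subtractf[symmetric]
      by (intro sum.cong refl) (simp add: A_def algebra_simps add_divide_distrib)
    also have "(\<Sum>i\<in>UNIV. \<Sum>j\<in>UNIV. z i * H j i u * z j) = Q z"
      unfolding Q_def by (subst sum.swap) (simp add: mult_ac)
    also have "(\<Sum>i\<in>UNIV. \<Sum>j\<in>UNIV. if i = j then z i * (\<epsilon> / 2) * z i else 0) =
        \<epsilon> / 2 * (\<Sum>i\<in>UNIV. (z i)\<^sup>2)"
      by (simp add: sum_distrib_left power2_eq_square mult_ac)
    finally show ?thesis by (simp add: Q_def)
  qed
  have "0 < (\<Sum>i\<in>UNIV. \<Sum>j\<in>UNIV. z i * A i j * z j)" if "\<exists>i\<in>UNIV. z i \<noteq> 0" for z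
  proof -
    have "0 < (\<Sum>i\<in>UNIV. (z i)\<^sup>2)" using that by (auto intro!: sum_pos2)
    then have "0 < \<epsilon> * (\<Sum>i\<in>UNIV. (z i)\<^sup>2)" using \<open>\<epsilon> > 0\<close> by simp
    then show ?thesis using Q_ge[of z] A[of z] by simp
  qed
  moreover have "A i j = A j i" for i j by (simp add: A_def)
  ultimately obtain r :: nat and W where W: "\<And>i j. A i j = (\<Sum>k<r. W k i * W k j)"
    using pos_def_sum_of_squares[of UNIV A] by auto
  have Q_sos: "Q z = (\<Sum>k<r. (\<Sum>i\<in>UNIV. W k i * z i)\<^sup>2) + \<epsilon> / 2 * (\<Sum>i\<in>UNIV. (z i)\<^sup>2)" for z
  proof -
    have "(\<Sum>k<r. (\<Sum>i\<in>UNIV. W k i * z i)\<^sup>2) = (\<Sum>i\<in>UNIV. \<Sum>j\<in>UNIV. z i * A i j * z j)"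
      unfolding W power2_eq_square sum_product sum_distrib_left sum_distrib_right
      by (subst sum.swap, subst (2) sum.swap) (simp add: mult_ac)
    then show ?thesis using A by simp
  qed
  \<comment> \<open>Each cross term costs at most \<open>\<eta> / 2 * (L i + L j)\<close>; summed
    over all \<open>i\<close> and \<open>j\<close> this is exactly the margin
    \<open>\<epsilon> / 2 * (\<Sum>i\<in>UNIV. L i)\<close>.\<close>
  define \<eta> where "\<eta> = \<epsilon> / (2 * CARD('n))"
  have "\<eta> > 0" using \<open>\<epsilon> > 0\<close> by (simp add: \<eta>_def)
  have "\<forall>\<^sub>F \<delta> in at_right 0. (\<lambda>x. \<eta>\<^sup>2 - (H i j x - H i j u)\<^sup>2) \<in> quadratic_module (ball_poly u \<delta>)" for i j
    using locally_small_diff[OF H, of u i j] \<open>\<eta> > 0\<close> unfolding locally_small_def by simp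
  then have "\<forall>\<^sub>F \<delta> in at_right 0. \<forall>i j.
      (\<lambda>x. \<eta>\<^sup>2 - (H i j x - H i j u)\<^sup>2) \<in> quadratic_module (ball_poly u \<delta>)"
    by (intro eventually_all_finite)
  then show ?thesis
  proof eventually_elim
    case (elim \<delta>)
    define R where "R i j D0 \<longleftrightarrow> (\<forall>D\<ge>D0. \<forall>F w a t h. psd_weights F w D (\<lambda>y. 1) \<longrightarrow>
      psd_weights F w D (ball_poly u \<delta>) \<longrightarrow> 0 \<le> ball_poly u \<delta> a \<longrightarrow> 0 \<le> t \<longrightarrow> t \<le> 1 \<longrightarrow>
      h \<in> polys_upto 1 \<longrightarrow> 0 \<le> weighted_sum F w
        (\<lambda>y. (\<eta>\<^sup>2 - (H i j (a + t *\<^sub>R (y - a)) - H i j u)\<^sup>2) * (h y)\<^sup>2))" for i j D0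
    have "\<exists>D0. R i j D0" for i j
      unfolding R_def by (rule psd_weights_quadratic_module[OF elim[rule_format]])
    then obtain D1 where D1: "\<And>i j. R i j (D1 i j)" by metis
    have "\<exists>D. (\<lambda>x. H i j x - H i j u) \<in> polys_upto D" for i j
      using H by (intro real_polynomial_function_polys_upto real_polynomial_function_diff
          real_polynomial_function.intros(2))
    then obtain D2 where D2: "\<And>i j. (\<lambda>x. H i j x - H i j u) \<in> polys_upto (D2 i j)" by metis
    define D0 where "D0 = Suc (\<Sum>i\<in>UNIV. \<Sum>j\<in>UNIV. D1 i j + D2 i j)"
    have D0: "D1 i j \<le> D0" "Suc (D2 i j) \<le> D0" for i j
    proof -
      have "D1 i j + D2 i j \<le> (\<Sum>j\<in>UNIV. D1 i j + D2 i j)"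
        by (rule member_le_sum[of j UNIV "\<lambda>j. D1 i j + D2 i j"]) auto
      also have "\<dots> \<le> (\<Sum>i\<in>UNIV. \<Sum>j\<in>UNIV. D1 i j + D2 i j)"
        by (rule member_le_sum[of i UNIV "\<lambda>i. \<Sum>j\<in>UNIV. D1 i j + D2 i j"]) auto
      finally show "D1 i j \<le> D0" "Suc (D2 i j) \<le> D0" by (simp_all add: D0_def)
    qed
    show "hessian_certificate g u \<delta>"
      unfolding hessian_certificate_def
    proof (intro exI[of _ D0] allI impI)
      fix D F w and a :: "real ^ 'n" and t :: real
      assume D: "D0 \<le> D" and psd: "psd_weights F w D (\<lambda>y :: real ^ 'n. 1)"
        and psd': "psd_weights F w D (ball_poly u \<delta>)"
        and a: "0 \<le> ball_poly u \<delta> a" and t: "0 \<le> t" "t \<le> 1"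
      define h where "h i y = y $ i - a $ i" for i and y :: "real ^ 'n"
      define e where "e i j y = H i j (a + t *\<^sub>R (y - a)) - H i j u" for i j y
      have h1: "h i \<in> polys_upto 1" for i
        unfolding h_def[abs_def] using polys_upto_coord_diff[of i "a $ i" 0]
        by (simp)
      have "1 \<le> D" using D by (simp add: D0_def)
      then have h: "h i \<in> polys_upto D" for i using h1 polys_upto_mono by blast
      have eh: "(\<lambda>y. e i j y * h i y) \<in> polys_upto D" for i j
        unfolding e_def using D D0(2)[of i j]
        by (intro polys_upto_mult_le[OF polys_upto_line[OF D2[of i j]] h1]) simp
      define L where "L i = weighted_sum F w (\<lambda>y. (h i y)\<^sup>2)" for i
      have L: "0 \<le> L i" for i unfolding L_def using psd_weights_square[OF psd h] .
      \<comment> \<open>Expand the nonnegative square of \<open>\<eta> * h j + e i j * h i\<close>,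
        use the certificate to replace the square of \<open>e i j\<close> by
        \<open>\<eta>\<^sup>2\<close>, and divide by \<open>2 * \<eta>\<close>.\<close>
      have cross: "- (\<eta> / 2) * (L i + L j) \<le> weighted_sum F w (\<lambda>y. h i y * h j y * e i j y)" for i j
      proof -
        let ?X = "weighted_sum F w (\<lambda>y. h i y * h j y * e i j y)"
        have "0 \<le> weighted_sum F w (\<lambda>y. (\<eta>\<^sup>2 - (e i j y)\<^sup>2) * (h i y)\<^sup>2)"
          unfolding e_def
          by (rule D1[unfolded R_def, rule_format, OF order.trans[OF D0(1) D] psd psd' a t h1])
        moreover have "0 \<le> weighted_sum F w (\<lambda>y. (\<eta> * h j y + e i j y * h i y)\<^sup>2)"
          by (intro psd_weights_square[OF psd] polys_upto_add polys_upto_scale h eh)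
        ultimately have "0 \<le> weighted_sum F w (\<lambda>y. (\<eta>\<^sup>2 - (e i j y)\<^sup>2) * (h i y)\<^sup>2
            + (\<eta> * h j y + e i j y * h i y)\<^sup>2)"
          unfolding weighted_sum_add by simp
        also have "(\<lambda>y. (\<eta>\<^sup>2 - (e i j y)\<^sup>2) * (h i y)\<^sup>2 + (\<eta> * h j y + e i j y * h i y)\<^sup>2) =
            (\<lambda>y. \<eta>\<^sup>2 * (h i y)\<^sup>2 + \<eta>\<^sup>2 * (h j y)\<^sup>2 + (2 * \<eta>) * (h i y * h j y * e i j y))"
          by (simp add: fun_eq_iff power2_eq_square algebra_simps)
        also have "weighted_sum F w \<dots> = 2 * \<eta> * (\<eta> / 2 * (L i + L j) + ?X)"
          unfolding weighted_sum_add weighted_sum_scale L_def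
          by (simp add: power2_eq_square algebra_simps)
        finally show ?thesis using \<open>\<eta> > 0\<close> by (simp add: zero_le_mult_iff)
      qed
      have lower: "(\<Sum>i\<in>UNIV. \<Sum>j\<in>UNIV. - (\<eta> / 2) * (L i + L j)) \<le>
          (\<Sum>i\<in>UNIV. \<Sum>j\<in>UNIV. weighted_sum F w (\<lambda>y. h i y * h j y * e i j y))"
        by (intro sum_mono cross)
      have "(\<Sum>i\<in>UNIV. \<Sum>j\<in>UNIV. - (\<eta> / 2) * (L i + L j)) = - (\<eta> / 2) * (2 * (CARD('n) * (\<Sum>i\<in>UNIV. L i)))"
        by (simp only: sum_distrib_left[symmetric] sum.distrib)
           (simp add: sum_distrib_left[symmetric])
      also have "\<dots> = - (\<epsilon> / 2) * (\<Sum>i\<in>UNIV. L i)"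
        by (simp add: \<eta>_def)
      finally have "- (\<epsilon> / 2) * (\<Sum>i\<in>UNIV. L i) \<le>
          (\<Sum>i\<in>UNIV. \<Sum>j\<in>UNIV. weighted_sum F w (\<lambda>y. h i y * h j y * e i j y))"
        using lower by simp
      moreover have "0 \<le> (\<Sum>k<r. weighted_sum F w (\<lambda>y. (\<Sum>i\<in>UNIV. W k i * h i y)\<^sup>2))"
        by (intro sum_nonneg psd_weights_square[OF psd] polys_upto_sum polys_upto_scale h)
      ultimately have "0 \<le> (\<Sum>k<r. weighted_sum F w (\<lambda>y. (\<Sum>i\<in>UNIV. W k i * h i y)\<^sup>2))
          + \<epsilon> / 2 * (\<Sum>i\<in>UNIV. L i)
          + (\<Sum>i\<in>UNIV. \<Sum>j\<in>UNIV. weighted_sum F w (\<lambda>y. h i y * h j y * e i j y))"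
        by simp
      also have "\<dots> = weighted_sum F w (\<lambda>y. (\<Sum>k<r. (\<Sum>i\<in>UNIV. W k i * h i y)\<^sup>2)
          + \<epsilon> / 2 * (\<Sum>i\<in>UNIV. (h i y)\<^sup>2) + (\<Sum>i\<in>UNIV. \<Sum>j\<in>UNIV. h i y * h j y * e i j y))"
        unfolding L_def by (simp only: weighted_sum_add weighted_sum_scale weighted_sum_sum)
      also have "(\<lambda>y. (\<Sum>k<r. (\<Sum>i\<in>UNIV. W k i * h i y)\<^sup>2)
          + \<epsilon> / 2 * (\<Sum>i\<in>UNIV. (h i y)\<^sup>2) + (\<Sum>i\<in>UNIV. \<Sum>j\<in>UNIV. h i y * h j y * e i j y)) =
          (\<lambda>y. \<Sum>i\<in>UNIV. \<Sum>j\<in>UNIV. (y - a) $ i * (y - a) $ j *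
            - partial_deriv i (partial_deriv j g) (a + t *\<^sub>R (y - a)))"
      proof
        fix y
        have "(\<Sum>k<r. (\<Sum>i\<in>UNIV. W k i * h i y)\<^sup>2) + \<epsilon> / 2 * (\<Sum>i\<in>UNIV. (h i y)\<^sup>2) = Q (\<lambda>i. h i y)"
          by (simp add: Q_sos)
        then show "(\<Sum>k<r. (\<Sum>i\<in>UNIV. W k i * h i y)\<^sup>2)
          + \<epsilon> / 2 * (\<Sum>i\<in>UNIV. (h i y)\<^sup>2) + (\<Sum>i\<in>UNIV. \<Sum>j\<in>UNIV. h i y * h j y * e i j y) =
          (\<Sum>i\<in>UNIV. \<Sum>j\<in>UNIV. (y - a) $ i * (y - a) $ j *
            - partial_deriv i (partial_deriv j g) (a + t *\<^sub>R (y - a)))"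
          unfolding Q_def
          by (simp only: sum.distrib[symmetric])
             (intro sum.cong refl, simp add: h_def e_def H_def algebra_simps)
      qed
      finally show "0 \<le> weighted_sum F w (\<lambda>y. \<Sum>i\<in>UNIV. \<Sum>j\<in>UNIV. (y - a) $ i * (y - a) $ j *
            - partial_deriv i (partial_deriv j g) (a + t *\<^sub>R (y - a)))" .
    qed
  qed
qed

section \<open>Strictly quasi-concave polynomials\<close>

text \<open>Compactness: on the part \<open>K\<close> of the unit sphere where the form is
  nonnegative, \<open>l \<bullet> v\<close> has no zero, so a large multiple of its square outweighs
  the form. The factor 2 matches the Hessian of \<open>c * f\<^sup>2\<close> at a zero of
  \<open>f\<close>.\<close>

lemma finsler:
  fixes A :: "real ^ 'n ^ 'n" and l :: "real ^ 'n"
  assumes "\<And>v. v \<noteq> 0 \<Longrightarrow> l \<bullet> v = 0 \<Longrightarrow> v \<bullet> (A *v v) < 0"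
  shows "\<exists>c\<ge>0. \<forall>v. v \<noteq> 0 \<longrightarrow> v \<bullet> (A *v v) - 2 * c * (l \<bullet> v)\<^sup>2 < 0"
proof -
  let ?q = "\<lambda>v. v \<bullet> (A *v v)"
  have cont: "continuous_on S ?q" for S
    by (intro continuous_intros linear_continuous_on matrix_vector_mul_bounded_linear)
  define K where "K = sphere 0 1 \<inter> {v. 0 \<le> ?q v}"
  have "closed {v. 0 \<le> ?q v}"
    by (intro closed_Collect_le continuous_on_const cont)
  then have "compact K" unfolding K_def by (intro compact_Int_closed) auto
  have "\<exists>c\<ge>0. \<forall>v\<in>sphere 0 1. ?q v - 2 * c * (l \<bullet> v)\<^sup>2 < 0"
  proof (cases "K = {}")
    case True
    then have "\<forall>v\<in>sphere 0 1. ?q v < 0" unfolding K_def by (auto simp: not_le[symmetric])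
    then show ?thesis by (intro exI[of _ 0]) auto
  next
    case False
    have cont_l: "continuous_on K (\<lambda>v. (l \<bullet> v)\<^sup>2)" by (intro continuous_intros)
    obtain v1 where v1: "v1 \<in> K" "\<And>v. v \<in> K \<Longrightarrow> (l \<bullet> v1)\<^sup>2 \<le> (l \<bullet> v)\<^sup>2"
      using continuous_attains_inf[OF \<open>compact K\<close> False cont_l] by auto
    obtain v2 where v2: "v2 \<in> K" "\<And>v. v \<in> K \<Longrightarrow> ?q v \<le> ?q v2"
      using continuous_attains_sup[OF \<open>compact K\<close> False cont] by auto
    have "l \<bullet> v1 \<noteq> 0" using assms[of v1] v1(1) unfolding K_def by fastforce
    then have m: "(l \<bullet> v1)\<^sup>2 > 0" by simp
    have M: "0 \<le> ?q v2" using v2(1) unfolding K_def by simp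
    \<comment> \<open>One more than the maximum of the form on \<open>K\<close>, divided by the
      minimum of \<open>(l \<bullet> v)\<^sup>2\<close> on \<open>K\<close>.\<close>
    define c where "c = (?q v2 + 1) / (l \<bullet> v1)\<^sup>2"
    have "c > 0" using m M by (simp add: c_def)
    have "?q v - 2 * c * (l \<bullet> v)\<^sup>2 < 0" if v: "v \<in> sphere 0 1" for v
    proof (cases "v \<in> K")
      case True
      have "?q v2 + 1 = c * (l \<bullet> v1)\<^sup>2" using m by (simp add: c_def)
      also have "\<dots> \<le> c * (l \<bullet> v)\<^sup>2" using v1(2)[OF True] \<open>c > 0\<close> by simp
      finally show ?thesis using v2(2)[OF True] M by linarith
    next
      case False
      then have "?q v < 0" using v unfolding K_def by auto
      moreover have "0 \<le> c * (l \<bullet> v)\<^sup>2" using \<open>c > 0\<close> by simp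
      ultimately show ?thesis by linarith
    qed
    then show ?thesis using \<open>c > 0\<close> by (intro exI[of _ c]) auto
  qed
  then obtain c where c: "c \<ge> 0" "\<And>v. v \<in> sphere 0 1 \<Longrightarrow> ?q v - 2 * c * (l \<bullet> v)\<^sup>2 < 0" by blast
  have "?q v - 2 * c * (l \<bullet> v)\<^sup>2 < 0" if "v \<noteq> 0" for v
  proof -
    define s where "s = v /\<^sub>R norm v"
    have v: "v = norm v *\<^sub>R s" using that by (simp add: s_def)
    have "?q v - 2 * c * (l \<bullet> v)\<^sup>2 = (norm v)\<^sup>2 * (?q s - 2 * c * (l \<bullet> s)\<^sup>2)"
      by (subst (1 2 3) v) (simp add: matrix_vector_mult_scaleR power2_eq_square algebra_simps)
    moreover have "?q s - 2 * c * (l \<bullet> s)\<^sup>2 < 0" using that by (intro c(2)) (simp add: s_def)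
    ultimately show ?thesis using that by (simp add: mult_pos_neg)
  qed
  then show ?thesis using c(1) by blast
qed

lemma partial_deriv_mult:
  fixes p q :: "real ^ 'n \<Rightarrow> real"
  assumes "real_polynomial_function p" "real_polynomial_function q"
  shows "partial_deriv i (\<lambda>x. p x * q x) x = p x * partial_deriv i q x + partial_deriv i p x * q x"
proof -
  have "((\<lambda>x. p x * q x) has_derivative
      (\<lambda>v. \<Sum>i\<in>UNIV. v $ i * (p x * partial_deriv i q x + partial_deriv i p x * q x))) (at x)"
    using has_derivative_mult[OF assms[THEN has_derivative_partial_deriv], of x]
    by (rule has_derivative_eq_rhs)
       (simp add: fun_eq_iff distrib_left sum.distrib sum_distrib_left sum_distrib_right mult_ac)
  then show ?thesis by (rule partial_deriv_eqI)
qed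

lemma partial_deriv_affine:
  fixes p :: "real ^ 'n \<Rightarrow> real"
  assumes "real_polynomial_function p"
  shows "partial_deriv i (\<lambda>x. a + b * p x) x = b * partial_deriv i p x"
proof -
  have "((\<lambda>x. a + b * p x) has_derivative (\<lambda>v. \<Sum>i\<in>UNIV. v $ i * (b * partial_deriv i p x))) (at x)"
    using has_derivative_add[OF has_derivative_const
        has_derivative_mult_right[OF has_derivative_partial_deriv[OF assms]], of a b x]
    by (rule has_derivative_eq_rhs) (simp add: fun_eq_iff sum_distrib_left mult_ac)
  then show ?thesis by (rule partial_deriv_eqI)
qed

text \<open>At a zero of \<open>f\<close> all terms with the factor \<open>f u\<close> drop out,
  leaving a rank one correction by the gradient.\<close>

lemma hessian_quadratic_modification:
  fixes f :: "real ^ 'n \<Rightarrow> real"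
  assumes f: "real_polynomial_function f" and "f u = 0"
  shows "v \<bullet> (hessian (\<lambda>x. f x * (1 + (- c) * f x)) u *v v) =
    v \<bullet> (hessian f u *v v) - 2 * c * (gradient f u \<bullet> v)\<^sup>2"
proof -
  have aff: "real_polynomial_function (\<lambda>x. 1 + a * f x)" for a
    using f by (intro real_polynomial_function.intros(2-4))
  have pd: "partial_deriv j (\<lambda>x. f x * (1 + (- c) * f x)) =
      (\<lambda>x. (1 + (- 2 * c) * f x) * partial_deriv j f x)" for j
    by (rule ext, subst partial_deriv_mult[OF f aff], subst partial_deriv_affine[OF f])
       (simp add: algebra_simps)
  have H: "partial_deriv i (partial_deriv j (\<lambda>x. f x * (1 + (- c) * f x))) u =
      partial_deriv i (partial_deriv j f) u - 2 * c * partial_deriv i f u * partial_deriv j f u" for i j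
    unfolding pd partial_deriv_mult[OF aff real_polynomial_function_partial_deriv[OF f]]
      partial_deriv_affine[OF f] using \<open>f u = 0\<close> by simp
  have grad: "(gradient f u \<bullet> v)\<^sup>2 = (\<Sum>i\<in>UNIV. \<Sum>j\<in>UNIV. v $ i * v $ j * (partial_deriv i f u * partial_deriv j f u))"
    by (simp add: power2_eq_square inner_vec_def gradient_def sum_product mult_ac)
  define G where "G = hessian (\<lambda>x. f x * (1 + (- c) * f x)) u"
  have G: "G $ i $ j = hessian f u $ i $ j - 2 * c * partial_deriv i f u * partial_deriv j f u" for i j
    unfolding G_def hessian_def by (simp only: vec_lambda_beta H)
  show ?thesis
    unfolding G_def[symmetric] grad inner_vec_def[of v] matrix_vector_mult_def vec_lambda_beta G
    by (simp add: sum_distrib_left sum_subtractf[symmetric] algebra_simps)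
qed

section \<open>Local representations\<close>

text \<open>The relaxation for the constant constraint \<open>1\<close>, which is sos-concave with a
  matrix \<open>W\<close> without rows.\<close>

lemma sdp_representable_cball: "0 \<le> \<delta> \<Longrightarrow> sdp_representable (cball (u :: real ^ 'n) \<delta>)"
proof -
  assume \<delta>: "0 \<le> \<delta>"
  have zero: "partial_deriv i (\<lambda>x. c) = (\<lambda>x :: real ^ 'n. 0)" for i and c :: real
    by (intro ext partial_deriv_eqI) simp
  have "sos_concave (\<lambda>x :: real ^ 'n. 1)"
    unfolding sos_concave_def hessian_def zero by (intro exI[of _ 0]) simp
  then have "sdp_representable {x. 0 \<le> (1::real) \<and> 0 \<le> ball_poly u \<delta> x}"
    by (intro sdp_representable_superlevel_ball real_polynomial_function.intros(2)
        sos_concave_hessian_certificate)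
  then show ?thesis using \<delta> by (simp add: ball_poly_nonneg del: mem_cball)
qed

lemma sdp_representable_local:
  fixes f :: "real ^ 'n \<Rightarrow> real"
  assumes f: "real_polynomial_function f" and "0 \<le> f u"
    and conc: "f u = 0 \<Longrightarrow> sos_concave f \<or> strictly_quasi_concave_at f u"
  shows "\<exists>\<delta>>0. sdp_representable (cball u \<delta> \<inter> {x. 0 \<le> f x})"
proof -
  have cont: "isCont f u" using continuous_real_polymonial_function[OF f] .
  consider "f u > 0" | "f u = 0" "sos_concave f" | "f u = 0" "strictly_quasi_concave_at f u"
    using assms by force
  then show ?thesis
  proof cases
    case 1
    \<comment> \<open>An inactive constraint stays positive on a whole ball by continuity.\<close>
    from order_tendstoD(1)[OF cont[unfolded isCont_def] 1]
    obtain d where d: "d > 0" "\<And>x. x \<noteq> u \<Longrightarrow> dist x u < d \<Longrightarrow> 0 < f x"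
      unfolding eventually_at by blast
    have "0 \<le> f x" if "x \<in> cball u (d / 2)" for x
      using 1 d(2)[of x] d(1) that by (cases "x = u") (auto simp: dist_commute)
    then have "cball u (d / 2) \<inter> {x. 0 \<le> f x} = cball u (d / 2)" by blast
    then show ?thesis using d(1) sdp_representable_cball[of "d / 2" u] by (intro exI[of _ "d / 2"]) simp
  next
    case 2
    have "cball u 1 \<inter> {x. 0 \<le> f x} = {x. 0 \<le> f x \<and> 0 \<le> ball_poly u 1 x}"
      by (auto simp: ball_poly_nonneg)
    then show ?thesis
      using sdp_representable_superlevel_ball[OF f sos_concave_hessian_certificate[OF 2(2)]]
      by (intro exI[of _ 1]) simp
  next
    case 3
    have "\<And>v. v \<noteq> 0 \<Longrightarrow> gradient f u \<bullet> v = 0 \<Longrightarrow> v \<bullet> (hessian f u *v v) < 0"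
      using 3(2) unfolding strictly_quasi_concave_at_def by force
    from finsler[OF this] obtain c where c: "c \<ge> 0"
      "\<And>v. v \<noteq> 0 \<Longrightarrow> v \<bullet> (hessian f u *v v) - 2 * c * (gradient f u \<bullet> v)\<^sup>2 < 0" by blast
    \<comment> \<open>\<open>g\<close> has a negative definite Hessian at \<open>u\<close> and
      shares the sign of \<open>f\<close> wherever the second factor is positive.\<close>
    define g where "g x = f x * (1 + (- c) * f x)" for x
    have g: "real_polynomial_function g"
      unfolding g_def[abs_def] using f by (intro real_polynomial_function.intros(2-4))
    have "v \<bullet> (hessian g u *v v) < 0" if "v \<noteq> 0" for v
      using c(2)[OF that] hessian_quadratic_modification[OF f 3(1), of v c]
      unfolding g_def[abs_def] by simp
    then have "\<forall>\<^sub>F \<delta> in at_right 0. hessian_certificate g u \<delta>"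
      by (rule neg_def_hessian_certificate[OF g])
    moreover have "\<forall>\<^sub>F x in at u. 0 < 1 + (- c) * f x"
    proof (rule order_tendstoD(1))
      show "((\<lambda>x. 1 + (- c) * f x) \<longlongrightarrow> 1 + (- c) * f u) (at u)"
        using cont unfolding isCont_def by (intro tendsto_intros)
      show "0 < 1 + (- c) * f u" using 3(1) by simp
    qed
    then obtain d where d: "d > 0" "\<And>x. x \<noteq> u \<Longrightarrow> dist x u < d \<Longrightarrow> 0 < 1 + (- c) * f x"
      unfolding eventually_at by blast
    moreover have "\<forall>\<^sub>F \<delta> in at_right 0. 0 < \<delta> \<and> \<delta> < d"
      using d(1) by (intro eventually_at_rightI[of 0 d]) auto
    ultimately have "\<forall>\<^sub>F \<delta> in at_right 0. hessian_certificate g u \<delta> \<and> 0 < \<delta> \<and> \<delta> < d"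
      using eventually_conj by blast
    then obtain \<delta> where \<delta>: "hessian_certificate g u \<delta>" "0 < \<delta>" "\<delta> < d"
      using eventually_happens'[OF trivial_limit_at_right_real] by blast
    have "0 \<le> g x \<longleftrightarrow> 0 \<le> f x" if "x \<in> cball u \<delta>" for x
    proof -
      have "0 < 1 + (- c) * f x"
        using d(2)[of x] that \<delta>(3) 3(1) by (cases "x = u") (auto simp: dist_commute)
      then show ?thesis unfolding g_def by (simp add: zero_le_mult_iff)
    qed
    then have "cball u \<delta> \<inter> {x. 0 \<le> f x} = {x. 0 \<le> g x \<and> 0 \<le> ball_poly u \<delta> x}"
      using \<delta>(2) by (auto simp: ball_poly_nonneg)
    then show ?thesis
      using sdp_representable_superlevel_ball[OF g \<delta>(1)] \<delta>(2) by (intro exI[of _ \<delta>]) simp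
  qed
qed

section \<open>The convex boundary\<close>

text \<open>The pairs of a point and a unit normal supporting \<open>T\<close> there form a compact
  set \<open>?P\<close>, and the convex boundary is its projection.\<close>

lemma compact_convex_boundary:
  fixes T :: "(real ^ 'n) set"
  assumes "compact T"
  shows "compact (convex_boundary T)"
proof -
  let ?P = "(T \<times> sphere 0 1) \<inter> (\<Inter>x\<in>T. {p. snd p \<bullet> fst p \<le> snd p \<bullet> x})"
  have "compact ?P"
    using assms by (intro compact_Int_closed compact_Times closed_INT ballI closed_Collect_le
        continuous_intros) auto
  then have "compact (fst ` ?P)"
    by (rule compact_continuous_image[rotated]) (intro continuous_intros)
  also have "fst ` ?P = convex_boundary T"
    unfolding convex_boundary_def by (force simp: image_iff)
  finally show ?thesis .
qed

text \<open>An extreme point of a hull with more than one point lies outside its relative interior,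
  so a hyperplane supports the hull there.\<close>

lemma extreme_point_in_convex_boundary:
  fixes T :: "(real ^ 'n) set"
  assumes x: "x extreme_point_of (convex hull T)"
  shows "x \<in> convex_boundary T"
proof -
  have "x \<in> T" using extreme_point_of_convex_hull[OF x] .
  have "\<exists>l. norm l = 1 \<and> (\<forall>y\<in>T. l \<bullet> x \<le> l \<bullet> y)"
  proof (cases "convex hull T = {x}")
    case True
    then have "T \<subseteq> {x}" using hull_subset[of T convex] by simp
    \<comment> \<open>Every unit vector supports a single point; the coordinate is
      arbitrary.\<close>
    then show ?thesis by (intro exI[of _ "axis undefined 1"]) auto
  next
    case False
    then have "x \<notin> rel_interior (convex hull T)"
      using extreme_point_not_in_REL_INTERIOR[OF x] by simp
    moreover have "x \<in> closure (convex hull T)"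
      using \<open>x \<in> T\<close> hull_subset[of T convex] closure_subset by blast
    ultimately obtain l where l: "l \<noteq> 0" "\<And>y. y \<in> closure (convex hull T) \<Longrightarrow> l \<bullet> x \<le> l \<bullet> y"
      using supporting_hyperplane_relative_frontier[OF convex_convex_hull] by metis
    have "\<forall>y\<in>T. (l /\<^sub>R norm l) \<bullet> x \<le> (l /\<^sub>R norm l) \<bullet> y"
      using l hull_subset[of T convex] closure_subset by (auto intro!: divide_right_mono simp: divide_inverse_commute[symmetric])
    moreover have "norm (l /\<^sub>R norm l) = 1" using l(1) by simp
    ultimately show ?thesis by blast
  qed
  then show ?thesis using \<open>x \<in> T\<close> unfolding convex_boundary_def by blast
qed

theorem theorem4p4:
  fixes f :: "nat \<Rightarrow> real ^ 'n \<Rightarrow> real" and m :: nat and T :: "(real ^ 'n) set"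
  assumes poly: "\<And>i. i \<in> {1..m} \<Longrightarrow> real_polynomial_function (f i)"
    and T_def: "T = {x. \<forall>i\<in>{1..m}. f i x \<ge> 0}"
    and compact: "compact T"
    and interior_near: "\<And>u. u \<in> convex_boundary T \<Longrightarrow>
      \<forall>\<^sub>F \<delta> in at_right 0. \<exists>v\<in>ball u \<delta>. \<forall>i\<in>{1..m}. f i v > 0"
    and concave: "\<And>u i. u \<in> convex_boundary T \<Longrightarrow> i \<in> {1..m} \<Longrightarrow> f i u = 0 \<Longrightarrow>
      sos_concave (f i) \<or> strictly_quasi_concave_at (f i) u"
  shows "sdp_representable (convex hull T)"
proof -
  \<comment> \<open>\<open>S\<close> is a representable part of \<open>T\<close> that contains all
    of \<open>T\<close> near \<open>u\<close>.\<close>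
  define piece where "piece u S r \<longleftrightarrow> sdp_representable S \<and> bounded S \<and> u \<in> S \<and> S \<subseteq> T \<and>
    0 < r \<and> T \<inter> ball u r \<subseteq> S" for u S r
  have "\<exists>S r. piece u S r" if u: "u \<in> convex_boundary T" for u
  proof -
    have "u \<in> T" using u by (simp add: convex_boundary_def)
    have "\<exists>\<delta>>0. sdp_representable (cball u \<delta> \<inter> {x. 0 \<le> f i x})" if "i \<in> {1..m}" for i
      using that \<open>u \<in> T\<close> concave[OF u] poly by (intro sdp_representable_local) (auto simp: T_def)
    then obtain \<delta> where \<delta>: "\<And>i. i \<in> {1..m} \<Longrightarrow> \<delta> i > 0"
      "\<And>i. i \<in> {1..m} \<Longrightarrow> sdp_representable (cball u (\<delta> i) \<inter> {x. 0 \<le> f i x})" by metis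
    \<comment> \<open>The unit ball keeps \<open>S\<close> bounded even for an empty list of
      constraints.\<close>
    define S where "S = cball u 1 \<inter> (\<Inter>i\<in>{1..m}. cball u (\<delta> i) \<inter> {x. 0 \<le> f i x})"
    \<comment> \<open>Inserting 1 keeps the minimum defined and \<open>ball u r\<close> inside the
      unit ball.\<close>
    define r where "r = Min (insert 1 (\<delta> ` {1..m}))"
    have r: "r \<le> 1" "\<And>i. i \<in> {1..m} \<Longrightarrow> r \<le> \<delta> i"
      unfolding r_def by (intro Min_le; simp)+
    have "r > 0" using \<delta>(1) by (auto simp: r_def)
    have "sdp_representable S"
      unfolding S_def using \<delta>(2)
      by (intro sdp_representable_Int[OF sdp_representable_cball sdp_representable_INT]) auto
    moreover have "bounded S" unfolding S_def by (intro bounded_Int) auto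
    moreover have "u \<in> S" using \<open>u \<in> T\<close> \<delta>(1) by (force simp: S_def T_def)
    moreover have "S \<subseteq> T" by (auto simp: S_def T_def)
    moreover have "T \<inter> ball u r \<subseteq> S" using r by (force simp: S_def T_def)
    ultimately show ?thesis using \<open>r > 0\<close> unfolding piece_def by blast
  qed
  then obtain S r where "\<And>u. u \<in> convex_boundary T \<Longrightarrow> piece u (S u) (r u)" by metis
  then have S: "sdp_representable (S u)" "bounded (S u)" "u \<in> S u" "S u \<subseteq> T" "0 < r u"
    "T \<inter> ball u (r u) \<subseteq> S u" if "u \<in> convex_boundary T" for u
    using that unfolding piece_def by blast+
  have cover: "convex_boundary T \<subseteq> (\<Union>u\<in>convex_boundary T. ball u (r u))"
    using S(5) by (intro subsetI UN_I) auto
  obtain K where K: "K \<subseteq> convex_boundary T" "finite K" "convex_boundary T \<subseteq> (\<Union>u\<in>K. ball u (r u))"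
    by (rule compactE_image[OF compact_convex_boundary[OF compact] open_ball cover])
  have "convex hull T \<subseteq> convex hull (\<Union>u\<in>K. S u)"
  proof -
    \<comment> \<open>By Krein-Milman only the extreme points of the hull have to be covered, and
      these lie in the convex boundary.\<close>
    have "{x. x extreme_point_of (convex hull T)} \<subseteq> (\<Union>u\<in>K. S u)"
    proof
      fix x assume "x \<in> {x. x extreme_point_of (convex hull T)}"
      then have x: "x \<in> convex_boundary T" by (simp add: extreme_point_in_convex_boundary)
      then obtain u where "u \<in> K" "x \<in> ball u (r u)" using K(3) by blast
      moreover have "x \<in> T" using x by (simp add: convex_boundary_def)
      ultimately show "x \<in> (\<Union>u\<in>K. S u)" using S(6) K(1) by blast
    qed
    then show ?thesis
      using Krein_Milman_Minkowski[OF compact_convex_hull[OF compact] convex_convex_hull] hull_mono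
      by metis
  qed
  moreover have "convex hull (\<Union>u\<in>K. S u) \<subseteq> convex hull T"
    using S(4) K(1) by (intro hull_mono) blast
  moreover have "sdp_representable (convex hull (\<Union>u\<in>K. S u))"
    using S(1-3) K(1) by (intro sdp_representable_convex_hull_UN[OF K(2)]) blast+
  ultimately show ?thesis by (metis subset_antisym)
qed

end
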